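(* Let $k\geq 3$ and let $\mathcal{G}$ be a $k$-uniform supertree of order $n$. Then $\rho(\mathcal{P}(n, k))\leq \rho(\mathcal{G})$, with equality if and only if $\mathcal{G}\cong \mathcal{P}(n, k)$.
   Context: A hypergraph $\mathcal{G}=(V,E)$ has a nonempty finite vertex set and a set of distinct edges, each a subset of $V$ with at least two vertices; $n=|V|$ is the order; it is $k$-uniform if all edges have $k$ vertices. Its adjacency matrix has $(\mathcal{A}_{\mathcal{G}})_{ij}=\sum_{e\in E,\ i,j\in e}\frac{1}{|e|-1}$ for $i\ne j$ and $0$ on the diagonal; $\rho(\mathcal{G})$ is the largest modulus of an eigenvalue of $\mathcal{A}_{\mathcal{G}}$. A supertree is a connected hypergraph with no (Berge) cycle $v_1e_1v_2\cdots v_qe_qv_1$ ($q\ge2$, distinct vertices, distinct edges, $v_i,v_{i+1}\in e_i$ indices mod $q$). A hyperpath of length $q$ is a sequence $v_1e_1v_2e_2\cdots v_qe_qv_{q+1}$ of distinct vertices and distinct edges with $v_i,v_{i+1}\in e_i$, $e_i\cap e_{i+1}=\{v_{i+1}\}$ for $1\le i\le q-1$, and $e_i\cap e_j=\emptyset$ for $|i-j|\ge2$. $\mathcal{P}(n,k)$ denotes the $k$-uniform hypergraph of order $n$ consisting of a hyperpath (its edges being exactly the edges of the hyperpath and its vertices exactly the vertices in them). *)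

theory Defs
  imports Complex_Main
begin

text \<open>A hypergraph is given by a vertex set V and an edge set E (a set of sets,
so edges are automatically distinct).\<close>
definition hypergraph :: "'a set \<Rightarrow> 'a set set \<Rightarrow> bool" where
  "hypergraph V E \<longleftrightarrow> finite V \<and> V \<noteq> {} \<and> (\<forall>e\<in>E. e \<subseteq> V \<and> card e \<ge> 2)"

definition k_uniform :: "nat \<Rightarrow> 'a set set \<Rightarrow> bool" where
  "k_uniform k E \<longleftrightarrow> (\<forall>e\<in>E. card e = k)"

text \<open>Adjacency matrix entries.\<close>
definition adj :: "'a set set \<Rightarrow> 'a \<Rightarrow> 'a \<Rightarrow> real" where
  "adj E i j = (if i = j then 0
     else (\<Sum>e\<in>{e\<in>E. i \<in> e \<and> j \<in> e}. 1 / (real (card e) - 1)))"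

text \<open>Complex eigenvalues of the adjacency matrix (rows/columns indexed by V).\<close>
definition adj_eigenvalue :: "'a set \<Rightarrow> 'a set set \<Rightarrow> complex \<Rightarrow> bool" where
  "adj_eigenvalue V E mu \<longleftrightarrow>
     (\<exists>x :: 'a \<Rightarrow> complex. (\<exists>i\<in>V. x i \<noteq> 0) \<and>
        (\<forall>i\<in>V. (\<Sum>j\<in>V. complex_of_real (adj E i j) * x j) = mu * x i))"

definition spectral_radius :: "'a set \<Rightarrow> 'a set set \<Rightarrow> real" where
  "spectral_radius V E = Max (cmod ` {mu. adj_eigenvalue V E mu})"

definition connected_hg :: "'a set \<Rightarrow> 'a set set \<Rightarrow> bool" where
  "connected_hg V E \<longleftrightarrow>
     (\<forall>u\<in>V. \<forall>v\<in>V. (u, v) \<in> {(a, b). \<exists>e\<in>E. a \<in> e \<and> b \<in> e}\<^sup>*)"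

text \<open>Berge cycle v_1 e_1 ... v_q e_q v_1 with q \<ge> 2 (0-indexed lists).\<close>
definition has_berge_cycle :: "'a set set \<Rightarrow> bool" where
  "has_berge_cycle E \<longleftrightarrow>
     (\<exists>vs es. length vs \<ge> 2 \<and> length es = length vs \<and> distinct vs \<and> distinct es \<and>
        set es \<subseteq> E \<and>
        (\<forall>i < length vs. vs ! i \<in> es ! i \<and> vs ! ((i + 1) mod length vs) \<in> es ! i))"

definition supertree :: "'a set \<Rightarrow> 'a set set \<Rightarrow> bool" where
  "supertree V E \<longleftrightarrow> hypergraph V E \<and> connected_hg V E \<and> \<not> has_berge_cycle E"

text \<open>Hyperpath v_1 e_1 v_2 ... v_q e_q v_{q+1} (0-indexed lists).\<close>
definition hyperpath :: "'a list \<Rightarrow> 'a set list \<Rightarrow> bool" where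
  "hyperpath vs es \<longleftrightarrow>
     length vs = length es + 1 \<and> distinct vs \<and> distinct es \<and>
     (\<forall>i < length es. vs ! i \<in> es ! i \<and> vs ! (i + 1) \<in> es ! i) \<and>
     (\<forall>i. i + 1 < length es \<longrightarrow> es ! i \<inter> es ! (i + 1) = {vs ! (i + 1)}) \<and>
     (\<forall>i j. i < length es \<and> j < length es \<and> i + 2 \<le> j \<longrightarrow> es ! i \<inter> es ! j = {})"

text \<open>A hypergraph consisting of a hyperpath: its edges are exactly those of
the hyperpath and its vertices exactly the vertices in them.\<close>
definition hyperpath_hypergraph :: "'a set \<Rightarrow> 'a set set \<Rightarrow> bool" where
  "hyperpath_hypergraph V E \<longleftrightarrow> hypergraph V E \<and>
     (\<exists>vs es. hyperpath vs es \<and> E = set es \<and> V = set vs \<union> \<Union>(set es))"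

definition hg_isomorphic :: "'a set \<Rightarrow> 'a set set \<Rightarrow> 'b set \<Rightarrow> 'b set set \<Rightarrow> bool" where
  "hg_isomorphic V E V' E' \<longleftrightarrow> (\<exists>f. bij_betw f V V' \<and> E' = (\<lambda>e. f ` e) ` E)"

end

theory Submission
  imports Defs "HOL-Analysis.Function_Topology" "HOL-Library.Disjoint_Sets"
    "Jordan_Normal_Form.Char_Poly"
begin

text \<open>Fix the Perron vector \<open>x\<close> of the supertree and let \<open>\<lambda> = (k - 1) \<rho>(G)\<close>. For a branch rooted
  at \<open>r\<close>, let \<open>F\<close> be the contribution of the branch to the eigenvector equation at \<open>r\<close>, divided by
  \<open>x r\<close>. Among all branches with \<open>m\<close> edges and \<open>F < \<lambda>\<close>, the pendant hyperpath rooted at its end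
  uniquely minimises \<open>F\<close>: replacing two paths that meet at a vertex, or at two vertices of an
  edge, by a single path strictly lowers \<open>F\<close>. This follows from product formulas for the
  Chebyshev-like solutions of the path recurrence. Applied to the supertree minus a pendant edge,
  this shows that the path recurrence for \<open>\<lambda>\<close> stays positive along the whole hyperpath, which
  yields a positive vector \<open>z\<close> on the hyperpath with \<open>(k - 1) \<A> z \<le> \<lambda> z\<close>, so that
  \<open>\<rho>(P) \<le> \<rho>(G)\<close>; equality forces every branch to be a path.\<close>

section \<open>The path recurrence\<close>

text \<open>Nothing ensures beforehand that the recurrence stays positive for as many edges as the
  supertree has: \<open>C\<close> oscillates when \<open>\<beta> < 2\<close>, and \<open>f j\<close>
  loses its meaning at the first nonpositive \<open>u\<close>. So every comparison proves
  \<open>good\<close> together with its inequality, and it is the slack left in the supertree that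
  carries positivity one edge further. The comparison succeeds because the slack, cleared of
  denominators, depends only on the total number of edges: merging two paths keeps this numerator,
  and the product formulas say that the denominator shrinks. The pendant edge is removed because the
  branch bound needs strict slack at the root, while the Perron equation of the whole supertree is
  tight at every vertex. Without the edge, the vertex that carried it has positive slack. Putting
  the edge back turns the bound into \<open>t - u \<ge> 0\<close> at the full number of edges, and
  \<open>t - u\<close> is precisely the amount by which \<open>z\<close> falls short of the
  eigenvector equation at the root of the hyperpath.\<close>

locale path_recurrence =
  fixes \<mu> \<kappa> :: real
  assumes kappa: "\<kappa> \<ge> 1" and mu: "\<mu> \<ge> \<kappa> + 2"
begin

text \<open>On a \<open>k\<close>-uniform hyperpath put \<open>\<kappa> = k - 2\<close> and \<open>\<mu> = \<lambda> + 1\<close>, where \<open>\<lambda>\<close> is an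
  eigenvalue of \<open>(k - 1) \<A>\<close>. Solving the eigenvector equation from one end, \<open>u j\<close> is the
  entry at the \<open>j\<close>-th joint and \<open>t j\<close> the sum of the entries over the edge that follows it;
  both are combinations of the Chebyshev-like solution \<open>C\<close> of the resulting three-term
  recurrence. A pendant path with \<open>j\<close> edges contributes \<open>f j\<close> times the entry of its root to
  the equation at that root, and \<open>g j = 1 / (\<mu> - f j)\<close> is the share of that entry in the sum
  over a further edge through the root. Only indices with \<open>good j\<close> are meaningful.\<close>

definition \<beta> :: real where "\<beta> = \<mu> - 1 - \<kappa> - \<kappa> / \<mu>"

fun C :: "nat \<Rightarrow> real" where
  "C 0 = 0"
| "C (Suc 0) = 1"
| "C (Suc (Suc n)) = \<beta> * C (Suc n) - C n"

definition u :: "nat \<Rightarrow> real" where "u n = C (Suc n) + \<kappa> / \<mu> * C n"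
definition t :: "nat \<Rightarrow> real" where "t n = \<mu> * C (Suc n) - C n"
definition f :: "nat \<Rightarrow> real" where "f n = \<mu> - t n / u n"
definition good :: "nat \<Rightarrow> bool" where "good n \<longleftrightarrow> (\<forall>j\<le>n. u j > 0)"

lemma mu_pos: "\<mu> > 0" using kappa mu by simp

lemma u_0 [simp]: "u 0 = 1" by (simp add: u_def)
lemma t_0 [simp]: "t 0 = \<mu>" by (simp add: t_def)
lemma f_0 [simp]: "f 0 = 0" by (simp add: f_def)
lemma good_0 [simp]: "good 0" by (simp add: good_def)

lemma u_1: "u (Suc 0) = \<mu> - 1 - \<kappa>"
  by (simp add: u_def \<beta>_def)

lemma alpha_pos: "1 - \<kappa> / \<mu> > 0" using mu_pos mu by simp

lemma beta_pos: "\<beta> > 0"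
proof -
  have "\<kappa> / \<mu> < 1" using alpha_pos by simp
  then show ?thesis using mu unfolding \<beta>_def by linarith
qed

lemma beta_less: "\<beta> < \<mu>"
  using kappa mu_pos unfolding \<beta>_def by (smt (verit) divide_nonneg_pos)

text \<open>The edge equation: an edge of sum \<open>t n\<close> contains the joints
  \<open>u n\<close> and \<open>u (Suc n)\<close>, and each of its \<open>\<kappa>\<close> other
  vertices holds \<open>t n / \<mu>\<close>.\<close>

lemma alpha_t: "(1 - \<kappa> / \<mu>) * t n = u n + u (Suc n)"
  using mu_pos by (simp add: t_def u_def \<beta>_def field_simps)

text \<open>The eigenvector equation at a joint of two edges. Eliminating \<open>t\<close> with
  \<open>alpha_t\<close> leaves a three-term recurrence for \<open>u\<close> with coefficient
  \<open>(1 - \<kappa> / \<mu>) * (\<mu> + 1) - 2\<close>, which is \<open>\<beta>\<close>.\<close>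

lemma t_add_t_Suc: "t n + t (Suc n) = (\<mu> + 1) * u (Suc n)"
  using mu_pos by (simp add: t_def u_def \<beta>_def field_simps)

section \<open>Addition and product formulas; \<open>C (Suc n)\<close> is the Chebyshev polynomial
  U_n at \<open>\<beta> / 2\<close>\<close>

lemma C_add: "C (Suc (a + b)) = C (Suc a) * C (Suc b) - C a * C b"
proof (induction b rule: C.induct)
  case (3 n)
  have "C (Suc (a + Suc (Suc n))) = \<beta> * C (Suc (a + Suc n)) - C (Suc (a + n))" by simp
  then show ?case unfolding 3 by (simp add: algebra_simps)
qed auto

lemma C_add': "C (a + b) = C (Suc a) * C b + C a * C (Suc b) - \<beta> * C a * C b"
proof (cases b)
  case (Suc c)
  have "C (a + b) = C (Suc (a + c))" by (simp add: Suc)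
  then show ?thesis unfolding C_add by (simp add: Suc algebra_simps)
qed simp

text \<open>At a first index with \<open>C (Suc j) \<le> 0\<close> and \<open>C j > 0\<close>,
  \<open>u (Suc j) = (\<beta> + \<kappa> / \<mu>) * C (Suc j) - C j\<close> would be
  negative.\<close>

lemma C_pos:
  assumes "good n" "1 \<le> j" "j \<le> n"
  shows "C j > 0"
  using assms(2,3)
proof (induction j)
  case (Suc j)
  show ?case
  proof (cases "j = 0")
    case False
    then have IH: "C j > 0" using Suc by simp
    show ?thesis
    proof (rule ccontr)
      assume "\<not> ?thesis"
      then have neg: "C (Suc j) \<le> 0" by simp
      then have "\<beta> * C (Suc j) \<le> 0" using beta_pos by (simp add: mult_nonneg_nonpos)
      moreover have "\<kappa> / \<mu> * C (Suc j) \<le> 0"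
        using neg kappa mu_pos by (intro mult_nonneg_nonpos divide_nonneg_pos) auto
      ultimately have "u (Suc j) < 0" using IH by (simp add: u_def)
      then show False using assms(1) Suc.prems unfolding good_def by force
    qed
  qed simp
qed simp

lemma C_nonneg: "good n \<Longrightarrow> C n \<ge> 0"
  using C_pos[of n n] by (cases "n = 0") auto

text \<open>For fixed \<open>b\<close> the left side solves the recurrence in \<open>a\<close> and
  vanishes at \<open>a = 0\<close>, so it is a multiple of \<open>C a\<close>; likewise in
  \<open>b\<close>. The constant is the value at \<open>a = b = 1\<close>, and only its positivity
  matters later.\<close>

lemma u_prod: "u a * u b - u (a + b) = (u 1 * \<kappa> / \<mu> + 1) * C a * C b"
proof -
  have "u (a + b) = C (Suc a) * C (Suc b) - C a * C b
      + \<kappa> / \<mu> * (C (Suc a) * C b + C a * C (Suc b) - \<beta> * C a * C b)"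
    unfolding u_def C_add C_add' ..
  moreover have "u 1 = \<beta> + \<kappa> / \<mu>" by (simp add: u_def)
  ultimately show ?thesis unfolding u_def[of a] u_def[of b]
    by (simp add: algebra_simps add_divide_distrib)
qed

text \<open>The analogue of \<open>u_prod\<close>, with the factor \<open>\<mu> = t 0\<close> needed
  to make the left side vanish at \<open>a = 0\<close>. The constant is positive by
  \<open>beta_less\<close>.\<close>

lemma t_prod: "t a * t b - \<mu> * t (a + b) = (\<mu>\<^sup>2 - \<beta> * \<mu> + 1) * C a * C b"
proof -
  have "t (a + b) = \<mu> * (C (Suc a) * C (Suc b) - C a * C b)
      - (C (Suc a) * C b + C a * C (Suc b) - \<beta> * C a * C b)"
    unfolding t_def C_add C_add' ..
  then show ?thesis unfolding t_def[of a] t_def[of b]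
    by (simp only: power2_eq_square) (simp add: algebra_simps)
qed

text \<open>Up to positive factors, both sides of each identity express how far the path
  of \<open>a + b\<close> (respectively \<open>a + b + 1\<close>) edges is from being critical; hence they
  depend on \<open>a + b\<close> only.\<close>
lemma vertex_defect: "t a * u b + t b * u a - (\<mu> + 1) * u a * u b = t (a + b) - u (a + b)"
proof -
  have 1: "u (a + b) = C (Suc a) * C (Suc b) - C a * C b
      + \<kappa> / \<mu> * (C (Suc a) * C b + C a * C (Suc b) - \<beta> * C a * C b)"
    unfolding u_def C_add C_add' ..
  have 2: "t (a + b) = \<mu> * (C (Suc a) * C (Suc b) - C a * C b)
      - (C (Suc a) * C b + C a * C (Suc b) - \<beta> * C a * C b)"
    unfolding t_def C_add C_add' ..
  show ?thesis unfolding 1 2 unfolding u_def t_def \<beta>_def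
    using mu_pos by (simp add: field_simps)
qed

lemma edge_defect:
  "(1 - \<kappa> / \<mu>) * t a * t b - u a * t b - u b * t a = (\<mu> - \<kappa> - 1) * t (a + b) - \<mu> * u (a + b)"
proof -
  have 1: "u (a + b) = C (Suc a) * C (Suc b) - C a * C b
      + \<kappa> / \<mu> * (C (Suc a) * C b + C a * C (Suc b) - \<beta> * C a * C b)"
    unfolding u_def C_add C_add' ..
  have 2: "t (a + b) = \<mu> * (C (Suc a) * C (Suc b) - C a * C b)
      - (C (Suc a) * C b + C a * C (Suc b) - \<beta> * C a * C b)"
    unfolding t_def C_add C_add' ..
  show ?thesis unfolding 1 2 unfolding u_def t_def \<beta>_def
    using mu_pos by (simp add: field_simps)
qed

text \<open>Identifies the right side of \<open>edge_defect\<close> with the vertex defect of a path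
  having one more edge, namely the edge that holds the two branches.\<close>

lemma edge_defect_eq: "(\<mu> - \<kappa> - 1) * t n - \<mu> * u n = t (Suc n) - u (Suc n)"
  unfolding u_def t_def C.simps \<beta>_def using mu_pos by (simp add: field_simps)

section \<open>Propagation of positivity and merging of two paths\<close>

lemma defect_u: "(1 - \<kappa> / \<mu>) * (t (a + Suc b) - u (a + Suc b)) = u (Suc a) * u (Suc b) - u a * u b"
proof -
  have "(1 - \<kappa> / \<mu>) * (t (a + Suc b) - u (a + Suc b))
      = (1 - \<kappa> / \<mu>) * (t a * u (Suc b) + (t (Suc b) - (\<mu> + 1) * u (Suc b)) * u a)"
    unfolding vertex_defect[symmetric] by (simp add: algebra_simps)
  also have "t (Suc b) - (\<mu> + 1) * u (Suc b) = - t b" using t_add_t_Suc[of b] by simp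
  also have "(1 - \<kappa> / \<mu>) * (t a * u (Suc b) + - t b * u a)
      = ((1 - \<kappa> / \<mu>) * t a) * u (Suc b) - ((1 - \<kappa> / \<mu>) * t b) * u a" by (simp add: algebra_simps)
  also have "\<dots> = u (Suc a) * u (Suc b) - u a * u b"
    unfolding alpha_t by (simp add: algebra_simps)
  finally show ?thesis .
qed

text \<open>Edges move one at a time from the second path to the first. The total, hence the
  positive defect, is unchanged, and \<open>defect_u\<close> then forces the next
  \<open>u (Suc a)\<close> to be positive.\<close>

lemma good_add:
  assumes "good a" "good b" "t (a + b) - u (a + b) > 0"
  shows "good (a + b)"
  using assms
proof (induction b arbitrary: a)
  case (Suc b)
  have "u (Suc a) * u (Suc b) - u a * u b > 0"
    using defect_u[of a b] Suc.prems(3) alpha_pos by (metis mult_pos_pos)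
  moreover have "u a > 0" "u b > 0" "u (Suc b) > 0" using Suc.prems by (simp_all add: good_def)
  ultimately have "u (Suc a) > 0"
    by (smt (verit, ccfv_SIG) mult_pos_pos zero_less_mult_pos2)
  then have "good (Suc a)" using Suc.prems(1) by (auto simp: good_def le_Suc_eq)
  moreover have "good b" using Suc.prems(2) by (simp add: good_def)
  ultimately show ?case using Suc.IH[of "Suc a"] Suc.prems(3) by simp
qed simp

text \<open>The slacks \<open>\<mu> - 1 - (f a + f b)\<close> and
  \<open>\<mu> - 1 - f (a + b)\<close> have the same numerator \<open>d\<close>, over
  \<open>u a * u b\<close> and \<open>u (a + b)\<close> respectively. By \<open>u_prod\<close> the
  merged denominator is no larger, and it is strictly smaller when both paths have edges.\<close>

lemma f_add_le:
  assumes "good a" "good b" "f a + f b < \<mu> - 1"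
  shows "good (a + b)" "f (a + b) \<le> f a + f b"
    "1 \<le> a \<Longrightarrow> 1 \<le> b \<Longrightarrow> f (a + b) < f a + f b"
proof -
  define d where "d = t (a + b) - u (a + b)"
  have pos: "u a > 0" "u b > 0" using assms by (simp_all add: good_def)
  have eq: "\<mu> - 1 - (f a + f b) = d / (u a * u b)"
    unfolding d_def vertex_defect[symmetric] f_def using pos by (simp add: field_simps)
  then have d: "d > 0" using assms(3) pos
    by (smt (verit) divide_nonpos_pos mult_pos_pos)
  then show good: "good (a + b)" using good_add assms(1,2) unfolding d_def by simp
  then have pos': "u (a + b) > 0" by (simp add: good_def)
  have eq': "\<mu> - 1 - f (a + b) = d / u (a + b)"
    unfolding d_def f_def using pos' by (simp add: field_simps)
  have u1: "u 1 > 0" using u_1 mu kappa by simp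
  then have c: "u 1 * \<kappa> / \<mu> + 1 > 0" using kappa mu_pos
    by (smt (verit, ccfv_SIG) divide_nonneg_pos mult_nonneg_nonneg)
  have "u (a + b) \<le> u a * u b"
    using u_prod[of a b] c C_nonneg[OF assms(1)] C_nonneg[OF assms(2)] by (smt (verit) mult_nonneg_nonneg)
  then have "d / (u a * u b) \<le> d / u (a + b)" using d pos' by (simp add: frac_le)
  then show "f (a + b) \<le> f a + f b" using eq eq' by linarith
  assume "1 \<le> a" "1 \<le> b"
  then have "C a > 0" "C b > 0" using C_pos assms(1,2) by auto
  then have "u (a + b) < u a * u b"
    using u_prod[of a b] c by (smt (verit) mult_pos_pos)
  then have "d / (u a * u b) < d / u (a + b)" using d pos' by (simp add: frac_less2)
  then show "f (a + b) < f a + f b" using eq eq' by linarith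
qed

definition g :: "nat \<Rightarrow> real" where "g n = u n / t n"

text \<open>The same mechanism inside one edge: two vertices with shares \<open>g a\<close> and
  \<open>g b\<close> are compared with a leaf, of share \<open>1 / \<mu> = g 0\<close>, and a vertex
  carrying all \<open>a + b\<close> edges. The slacks have a common numerator over
  \<open>t a * t b\<close> and \<open>t 0 * t (a + b)\<close>.\<close>

lemma g_add_le:
  assumes "good a" "good b" "t a > 0" "t b > 0" "\<kappa> / \<mu> + g a + g b < 1"
  shows "good (a + b)" "t (a + b) > 0" "1 / \<mu> + g (a + b) \<le> g a + g b"
    "1 \<le> a \<Longrightarrow> 1 \<le> b \<Longrightarrow> 1 / \<mu> + g (a + b) < g a + g b"
proof -
  define d where "d = (\<mu> - \<kappa> - 1) * t (a + b) - \<mu> * u (a + b)"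
  have pos: "u a > 0" "u b > 0" using assms by (simp_all add: good_def)
  have eq: "1 - \<kappa> / \<mu> - (g a + g b) = d / (t a * t b)"
    unfolding d_def edge_defect[symmetric] g_def using assms(3,4) by (simp add: field_simps)
  then have d: "d > 0" using assms
    by (smt (verit) divide_nonpos_pos mult_pos_pos)
  have d': "d = t (a + Suc b) - u (a + Suc b)" unfolding d_def edge_defect_eq by simp
  have W: "u (Suc a) * u (Suc b) > u a * u b"
    using defect_u[of a b] d alpha_pos unfolding d'
    by (metis diff_gt_0_iff_gt mult_pos_pos)
  \<comment> \<open>Unlike in \<open>good_add\<close>, neither \<open>u (Suc a)\<close> nor
    \<open>u (Suc b)\<close> is known to be positive, so \<open>W\<close> alone would allow both to
    be negative. These bounds exclude that: the product of the absolute values would be at most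
    \<open>u a * u b\<close>.\<close>
  have sa: "- u (Suc a) < u a" "- u (Suc b) < u b"
    using alpha_t[of a] alpha_t[of b] alpha_pos assms(3,4)
    by (smt (verit) mult_pos_pos)+
  have ua: "u (Suc a) > 0"
  proof (rule ccontr)
    assume *: "\<not> ?thesis"
    then have "u (Suc b) < 0" using W pos
      by (smt (verit) mult_nonpos_nonneg mult_pos_pos)
    then have "(- u (Suc a)) * (- u (Suc b)) \<le> u a * u b"
      using sa * pos by (intro mult_mono) auto
    then show False using W by simp
  qed
  then have "good (Suc a)" using assms(1) by (auto simp: good_def le_Suc_eq)
  then have good': "good (Suc a + b)" using good_add[of "Suc a" b] assms(2) d d' by simp
  then show good: "good (a + b)" by (simp add: good_def)
  have "u (a + b) > 0" "u (Suc (a + b)) > 0" using good' by (simp_all add: good_def)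
  then show t: "t (a + b) > 0" using alpha_t[of "a + b"] alpha_pos
    by (metis add_pos_pos zero_less_mult_pos)
  have eq': "1 - \<kappa> / \<mu> - (1 / \<mu> + g (a + b)) = d / (\<mu> * t (a + b))"
    unfolding d_def g_def using t mu_pos by (simp add: field_simps)
  have c: "\<mu>\<^sup>2 - \<beta> * \<mu> + 1 > 0" using beta_less mu_pos
    by (smt (verit) mult_strict_right_mono power2_eq_square)
  have "\<mu> * t (a + b) \<le> t a * t b"
    using t_prod[of a b] c C_nonneg[OF assms(1)] C_nonneg[OF assms(2)] by (smt (verit) mult_nonneg_nonneg)
  then have "d / (t a * t b) \<le> d / (\<mu> * t (a + b))" using d t mu_pos by (simp add: frac_le)
  then show "1 / \<mu> + g (a + b) \<le> g a + g b" using eq eq' by linarith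
  assume "1 \<le> a" "1 \<le> b"
  then have "C a > 0" "C b > 0" using C_pos assms(1,2) by auto
  then have "\<mu> * t (a + b) < t a * t b"
    using t_prod[of a b] c by (smt (verit) mult_pos_pos)
  then have "d / (t a * t b) < d / (\<mu> * t (a + b))" using d t mu_pos by (simp add: frac_less2)
  then show "1 / \<mu> + g (a + b) < g a + g b" using eq eq' by linarith
qed

end

section \<open>Rooted supertrees and rooted hyperpaths\<close>

text \<open>On a \<open>k\<close>-uniform hypergraph this is \<open>k - 1\<close> times the
  adjacency operator (\<open>adj_sum_flow\<close>). Without the factor \<open>1 / (k - 1)\<close> it
  is a plain sum over edges, hence additive under grafting.\<close>

definition flow :: "'a set set \<Rightarrow> ('a \<Rightarrow> real) \<Rightarrow> 'a \<Rightarrow> real" where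
  "flow E x v = (\<Sum>e\<in>{e\<in>E. v \<in> e}. sum x e - x v)"

text \<open>In a graft step \<open>w = r\<close> is allowed: the tree grafted at \<open>r\<close> carries the other edges at
  the root, so roots of any degree are covered.\<close>

inductive rooted_supertree :: "nat \<Rightarrow> 'a \<Rightarrow> 'a set \<Rightarrow> 'a set set \<Rightarrow> bool" for k where
  single: "rooted_supertree k r {r} {}"
| graft: "rooted_supertree k r (\<Union>w\<in>e. Vf w) (insert e (\<Union>w\<in>e. Ef w))"
  if "card e = k" and "r \<in> e" and "\<forall>w\<in>e. rooted_supertree k w (Vf w) (Ef w)"
    and "disjoint_family_on Vf e"

text \<open>Built from the far end: \<open>w\<close> is the old root and \<open>e\<close> the new
  first edge. Since \<open>e \<inter> V = {w}\<close>, the new root lies in no earlier edge, so the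
  path is always rooted at an end.\<close>

inductive rooted_path :: "nat \<Rightarrow> 'a \<Rightarrow> 'a set \<Rightarrow> 'a set set \<Rightarrow> bool" for k where
  path_single: "rooted_path k r {r} {}"
| path_step: "rooted_path k r (V \<union> e) (insert e E)"
  if "rooted_path k w V E" "card e = k" "r \<in> e" "w \<in> e" "r \<noteq> w" "e \<inter> V = {w}"

lemma rooted_supertree_basic:
  assumes "rooted_supertree k r V E" "k \<ge> 2"
  shows "finite V" "finite E" "r \<in> V" "\<And>e. e \<in> E \<Longrightarrow> e \<subseteq> V \<and> card e = k"
  using assms(1)
proof (induction rule: rooted_supertree.induct)
  case (graft e r Vf Ef)
  have fe: "finite e" using graft(1) assms(2) by (metis card.infinite not_numeral_le_zero)
  {
    case 1 show ?case using graft fe by auto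
  next
    case 2 show ?case using graft fe by auto
  next
    case 3 show ?case using graft by auto
  next
    case (4 e') then show ?case using graft by blast
  }
qed auto

lemma graft_facts:
  assumes "k \<ge> 2" "card e = k" "\<forall>w\<in>e. rooted_supertree k w (Vf w) (Ef w)"
    and dfam: "disjoint_family_on Vf e"
  shows "finite e"
    and "\<And>w. w \<in> e \<Longrightarrow> Vf w \<inter> e = {w}"
    and "\<And>w. w \<in> e \<Longrightarrow> e \<notin> Ef w"
    and "\<And>w w'. w \<in> e \<Longrightarrow> w' \<in> e \<Longrightarrow> w \<noteq> w' \<Longrightarrow> Ef w \<inter> Ef w' = {}"
    and "card (insert e (\<Union>w\<in>e. Ef w)) = Suc (\<Sum>w\<in>e. card (Ef w))"
    and "card (\<Union>w\<in>e. Vf w) = (\<Sum>w\<in>e. card (Vf w))"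
    and "\<And>w v. w \<in> e \<Longrightarrow> v \<in> Vf w \<Longrightarrow> {e' \<in> insert e (\<Union>w\<in>e. Ef w). v \<in> e'} =
           (if v = w then insert e {e' \<in> Ef w. v \<in> e'} else {e' \<in> Ef w. v \<in> e'})"
proof -
  note basic = rooted_supertree_basic[OF assms(3)[rule_format] \<open>k \<ge> 2\<close>]
  have disj: "Vf w \<inter> Vf w' = {}" if "w \<in> e" "w' \<in> e" "w \<noteq> w'" for w w'
    using dfam that by (simp add: disjoint_family_on_def)
  show fe: "finite e" using assms(1,2) by (metis card.infinite not_numeral_le_zero)
  show Ve: "Vf w \<inter> e = {w}" if "w \<in> e" for w
    using basic(3) disj that by blast
  show eE: "e \<notin> Ef w" if w: "w \<in> e" for w
  proof
    assume "e \<in> Ef w"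
    then have "e \<subseteq> Vf w" using basic(4) w by blast
    then have "e \<subseteq> {w}" using Ve[OF w] by blast
    then have "card e \<le> 1" using card_mono[of "{w}" e] by simp
    then show False using assms by simp
  qed
  show dE: "Ef w \<inter> Ef w' = {}" if w: "w \<in> e" "w' \<in> e" "w \<noteq> w'" for w w'
  proof (rule ccontr)
    assume "Ef w \<inter> Ef w' \<noteq> {}"
    then obtain e' where e': "e' \<in> Ef w" "e' \<in> Ef w'" by blast
    then have "e' \<subseteq> Vf w \<inter> Vf w'" "card e' = k" using basic(4) w by blast+
    then show False using disj[OF w] assms(1) by auto
  qed
  show "card (insert e (\<Union>w\<in>e. Ef w)) = Suc (\<Sum>w\<in>e. card (Ef w))"
  proof -
    have "card (insert e (\<Union>w\<in>e. Ef w)) = Suc (card (\<Union>w\<in>e. Ef w))"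
      using fe eE basic(2) by (subst card_insert_disjoint) auto
    also have "card (\<Union>w\<in>e. Ef w) = (\<Sum>w\<in>e. card (Ef w))"
      using fe basic(2) dE by (intro card_UN_disjoint) auto
    finally show ?thesis .
  qed
  show "card (\<Union>w\<in>e. Vf w) = (\<Sum>w\<in>e. card (Vf w))"
    using fe basic(1) disj by (intro card_UN_disjoint) auto
  show "{e' \<in> insert e (\<Union>w\<in>e. Ef w). v \<in> e'} =
           (if v = w then insert e {e' \<in> Ef w. v \<in> e'} else {e' \<in> Ef w. v \<in> e'})"
    if w: "w \<in> e" and v: "v \<in> Vf w" for w v
  proof -
    have "w' = w" if "w' \<in> e" "e' \<in> Ef w'" "v \<in> e'" for w' e'
      using disj[OF w that(1)] basic(4)[OF that(1,2)] that(3) v by blast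
    moreover have "v \<in> e \<longleftrightarrow> v = w" using Ve[OF w] v by blast
    ultimately show ?thesis using w by auto
  qed
qed

lemma flow_graft:
  assumes "k \<ge> 2" "card e = k" "\<forall>w\<in>e. rooted_supertree k w (Vf w) (Ef w)"
    and "disjoint_family_on Vf e"
    and w: "w \<in> e" "v \<in> Vf w"
  shows "flow (insert e (\<Union>w\<in>e. Ef w)) x v =
           (if v = w then sum x e - x v + flow (Ef w) x v else flow (Ef w) x v)"
proof -
  define A where "A = insert e (\<Union>w\<in>e. Ef w)"
  have "{e' \<in> A. v \<in> e'} = (if v = w then insert e {e' \<in> Ef w. v \<in> e'} else {e' \<in> Ef w. v \<in> e'})"
    unfolding A_def using graft_facts(7)[OF assms(1-4) w] .
  then have "flow A x v = (if v = w then sum x e - x v + flow (Ef w) x v else flow (Ef w) x v)"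
    unfolding flow_def
    using graft_facts(3)[OF assms(1-4) w(1)]
      rooted_supertree_basic(2)[OF assms(3)[rule_format, OF w(1)] assms(1)] by auto
  then show ?thesis unfolding A_def .
qed

lemma rooted_supertree_card:
  assumes "rooted_supertree k r V E" "k \<ge> 2"
  shows "card V = card E * (k - 1) + 1"
  using assms
proof (induction rule: rooted_supertree.induct)
  case (graft e r Vf Ef)
  have rt: "\<forall>w\<in>e. rooted_supertree k w (Vf w) (Ef w)" using graft.IH by blast
  note gf = graft_facts[OF \<open>k \<ge> 2\<close> graft.hyps(1) rt graft.hyps(3)]
  have "card (\<Union>w\<in>e. Vf w) = (\<Sum>w\<in>e. card (Ef w) * (k - 1) + 1)"
    using gf(6) graft.IH \<open>k \<ge> 2\<close> by simp
  also have "\<dots> = (\<Sum>w\<in>e. card (Ef w)) * (k - 1) + k"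
    by (simp only: sum.distrib sum_distrib_right) (simp add: graft(1))
  also have "\<dots> = Suc (\<Sum>w\<in>e. card (Ef w)) * (k - 1) + 1" using \<open>k \<ge> 2\<close> by simp
  finally show ?case using gf(5) by simp
qed simp

lemma rooted_supertree_trivial:
  assumes "rooted_supertree k r V E" "E = {}" shows "V = {r}"
  using assms by (auto elim: rooted_supertree.cases)

lemma rooted_supertree_root_edge:
  assumes "rooted_supertree k r V E" "E \<noteq> {}" shows "\<exists>e\<in>E. r \<in> e"
  using assms by (cases rule: rooted_supertree.cases) auto

text \<open>Descends into a branch that still has edges. The clause \<open>v \<noteq> r\<close>
  serves the induction: it keeps the pendant vertices of the branch away from the branch's root, the
  only vertex where grafting adds an edge.\<close>

lemma pendant_edge_exists:
  assumes "rooted_supertree k r V E" "k \<ge> 2" "E \<noteq> {}"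
  shows "\<exists>e\<in>E. \<exists>w\<in>e. \<forall>v\<in>e - {w}. v \<noteq> r \<and> (\<forall>e'\<in>E. v \<in> e' \<longrightarrow> e' = e)"
  using assms
proof (induction rule: rooted_supertree.induct)
  case (graft e r Vf Ef)
  have rt: "\<forall>w\<in>e. rooted_supertree k w (Vf w) (Ef w)" using graft.IH by blast
  note gf = graft_facts[OF \<open>k \<ge> 2\<close> graft.hyps(1) rt graft.hyps(3)]
  show ?case
  proof (cases "\<exists>w\<in>e. Ef w \<noteq> {}")
    case True
    then obtain w where w: "w \<in> e" "Ef w \<noteq> {}" by blast
    have "\<exists>e\<in>Ef w. \<exists>w'\<in>e. \<forall>v\<in>e - {w'}. v \<noteq> w \<and> (\<forall>e'\<in>Ef w. v \<in> e' \<longrightarrow> e' = e)"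
      using graft.IH[rule_format, OF w(1)] \<open>k \<ge> 2\<close> w(2) by simp
    then obtain e1 w1 where e1: "e1 \<in> Ef w" "w1 \<in> e1"
      "\<forall>v\<in>e1 - {w1}. v \<noteq> w \<and> (\<forall>e'\<in>Ef w. v \<in> e' \<longrightarrow> e' = e1)"
      by blast
    have sub: "e1 \<subseteq> Vf w" using rooted_supertree_basic(4)[OF rt[rule_format, OF w(1)] \<open>k \<ge> 2\<close> e1(1)] by blast
    have "v \<noteq> r \<and> (\<forall>e'\<in>insert e (\<Union>w\<in>e. Ef w). v \<in> e' \<longrightarrow> e' = e1)" if v: "v \<in> e1 - {w1}" for v
    proof -
      have "v \<in> Vf w" "v \<noteq> w" using v sub e1 by auto
      moreover have "{e' \<in> insert e (\<Union>w\<in>e. Ef w). v \<in> e'} = {e' \<in> Ef w. v \<in> e'}"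
        using gf(7)[OF w(1)] calculation by simp
      moreover have "v \<notin> e" using gf(2)[OF w(1)] calculation by blast
      ultimately show ?thesis using e1(3) v graft(2) by blast
    qed
    moreover have "e1 \<in> insert e (\<Union>w\<in>e. Ef w)" using e1(1) w(1) by blast
    ultimately show ?thesis using e1(2) by (intro bexI[of _ e1] bexI[of _ w1] ballI)
  next
    case False
    then have E: "insert e (\<Union>w\<in>e. Ef w) = {e}" by auto
    show ?thesis unfolding E using graft.hyps(2) by auto
  qed
qed simp

lemma rooted_path_basic:
  assumes "rooted_path k r V E" "k \<ge> 2"
  shows "finite V" "finite E" "r \<in> V" "\<And>e. e \<in> E \<Longrightarrow> e \<subseteq> V \<and> card e = k"
    "card V = card E * (k - 1) + 1"
  using assms(1)
proof (induction rule: rooted_path.induct)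
  case (path_step w V E e r)
  have fe: "finite e" using path_step(2) assms(2) by (metis card.infinite not_numeral_le_zero)
  {
    case 1 show ?case using path_step fe by auto
  next
    case 2 show ?case using path_step fe by auto
  next
    case 3 show ?case using path_step by auto
  next
    case (4 e') then show ?case using path_step by blast
  next
    case 5
    have "e \<notin> E" using path_step.IH(4)[of e] path_step.hyps by blast
    then have "card (insert e E) = Suc (card E)" using path_step.IH(2) by simp
    moreover have "card (V \<union> e) + card (V \<inter> e) = card V + card e"
      using card_Un_Int path_step.IH(1) fe by metis
    moreover have "V \<inter> e = {w}" using path_step by blast
    ultimately show ?case using path_step.IH(5) path_step.hyps assms(2) by simp
  }
qed auto

lemma rooted_path_step_facts:
  assumes "rooted_path k w V E" "card e = k" "r \<in> e" "w \<in> e" "r \<noteq> w" "e \<inter> V = {w}" "k \<ge> 2"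
  shows "finite e" "e \<notin> E" "card (insert e E) = Suc (card E)"
    "\<And>x v. v \<in> V \<Longrightarrow> flow (insert e E) x v = (if v = w then sum x e - x v else 0) + flow E x v"
    "\<And>x v. v \<in> e - {w} \<Longrightarrow> flow (insert e E) x v = sum x e - x v"
proof -
  note basic = rooted_path_basic[OF assms(1,7)]
  show fe: "finite e" using assms(2,7) by (metis card.infinite not_numeral_le_zero)
  show eE: "e \<notin> E" using basic(4)[of e] assms by blast
  show "card (insert e E) = Suc (card E)" using eE basic(2) by simp
  show "flow (insert e E) x v = (if v = w then sum x e - x v else 0) + flow E x v" if v: "v \<in> V" for x v
  proof -
    have "{e' \<in> insert e E. v \<in> e'} = (if v = w then insert e {e'\<in>E. v \<in> e'} else {e'\<in>E. v \<in> e'})"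
      using v assms by auto
    then show ?thesis unfolding flow_def using eE basic(2) by simp
  qed
  show "flow (insert e E) x v = sum x e - x v" if v: "v \<in> e - {w}" for x v
  proof -
    have "{e' \<in> insert e E. v \<in> e'} = {e}" using v assms(6) basic(4) by blast
    then show ?thesis unfolding flow_def by simp
  qed
qed

section \<open>Connectedness and uniqueness of rooted hyperpaths\<close>

abbreviation joined :: "'a set set \<Rightarrow> ('a \<times> 'a) set" where
  "joined E \<equiv> {(a, b). \<exists>e\<in>E. a \<in> e \<and> b \<in> e}"

lemma joined_sym: "(a, b) \<in> (joined E)\<^sup>* \<Longrightarrow> (b, a) \<in> (joined E)\<^sup>*"
  using sym_rtrancl[of "joined E"] by (auto simp: sym_def)

lemma rooted_path_connected:
  assumes "rooted_path k r V E"
  shows "v \<in> V \<Longrightarrow> (r, v) \<in> (joined E)\<^sup>*"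
  using assms
proof (induction arbitrary: v rule: rooted_path.induct)
  case (path_step w V E e r)
  show ?case
  proof (cases "v \<in> e")
    case True
    then show ?thesis using path_step.hyps by blast
  next
    case False
    then have "(w, v) \<in> (joined E)\<^sup>*" using path_step by blast
    then have "(w, v) \<in> (joined (insert e E))\<^sup>*"
      by (rule rtrancl_mono[THEN subsetD, rotated]) auto
    moreover have "(r, w) \<in> joined (insert e E)" using path_step.hyps by blast
    ultimately show ?thesis by (rule converse_rtrancl_into_rtrancl[rotated])
  qed
qed simp

lemma connected_hg_if_root:
  assumes "\<And>v. v \<in> V \<Longrightarrow> (r, v) \<in> (joined E)\<^sup>*"
  shows "connected_hg V E"
proof -
  have "sym ((joined E)\<^sup>*)" by (intro sym_rtrancl) (auto simp: sym_def)
  then show ?thesis unfolding connected_hg_def using assms by (meson rtrancl_trans symD)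
qed

text \<open>Matching the roots is what makes the induction work: the old root is the only vertex
  shared with the new edge, so the map on the tail extends by any bijection of the new vertices that
  sends \<open>r\<close> to \<open>r'\<close>.\<close>

lemma rooted_path_isomorphic:
  assumes "rooted_path k r V E" "rooted_path k r' V' E'" "card E = card E'" "k \<ge> 2"
  shows "\<exists>f. bij_betw f V V' \<and> f r = r' \<and> E' = (\<lambda>e. f ` e) ` E"
  using assms
proof (induction arbitrary: r' V' E' rule: rooted_path.induct)
  case (path_single r)
  have "E' = {}" using path_single rooted_path_basic(2)[OF path_single(1)] by simp
  with path_single(1) have "V' = {r'}" by (auto elim: rooted_path.cases)
  then show ?case using \<open>E' = {}\<close> by (intro exI[of _ "\<lambda>_. r'"]) (auto simp: bij_betw_def)
next
  case (path_step w V E e r)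
  note facts = rooted_path_step_facts[OF path_step.hyps \<open>k \<ge> 2\<close>]
  have "E' \<noteq> {}" using facts(3) path_step.prems(2) by auto
  with path_step.prems(1) obtain V1 e1 E1 w1 where 1: "V' = V1 \<union> e1" "E' = insert e1 E1"
    "rooted_path k w1 V1 E1" "card e1 = k" "r' \<in> e1" "w1 \<in> e1" "r' \<noteq> w1" "e1 \<inter> V1 = {w1}"
    by (cases rule: rooted_path.cases) auto
  note facts1 = rooted_path_step_facts[OF 1(3-8) \<open>k \<ge> 2\<close>]
  have "card E = card E1" using facts(3) facts1(3) path_step.prems(2) 1(2) by simp
  then obtain f where f: "bij_betw f V V1" "f w = w1" "E1 = (\<lambda>e. f ` e) ` E"
    using path_step.IH[OF 1(3) _ \<open>k \<ge> 2\<close>] by blast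
  have "card (e - {w, r}) = card (e1 - {w1, r'})"
    using path_step.hyps 1 facts(1) facts1(1) by (simp add: card_Diff_subset)
  then obtain h where h: "bij_betw h (e - {w, r}) (e1 - {w1, r'})"
    using facts(1) facts1(1) by (metis finite_Diff finite_same_card_bij)
  define f' where "f' v = (if v \<in> V then f v else if v = r then r' else h v)" for v
  have rV: "r \<notin> V" "r' \<notin> V1" "w \<in> V" "w1 \<in> V1" using path_step.hyps 1 by blast+
  have b1: "bij_betw f' V V1" using f(1) by (rule bij_betw_cong[THEN iffD1, rotated]) (simp add: f'_def)
  have b2: "bij_betw f' {r} {r'}" using rV by (simp add: f'_def bij_betw_def)
  have b3: "bij_betw f' (e - {w, r}) (e1 - {w1, r'})"
    using h by (rule bij_betw_cong[THEN iffD1, rotated]) (use path_step.hyps in \<open>auto simp: f'_def\<close>)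
  have b23: "bij_betw f' ({r} \<union> (e - {w, r})) ({r'} \<union> (e1 - {w1, r'}))"
    using b2 b3 by (rule bij_betw_combine) auto
  have e: "{r} \<union> (e - {w, r}) = e - {w}" "{r'} \<union> (e1 - {w1, r'}) = e1 - {w1}"
    using path_step.hyps 1 by auto
  have "bij_betw f' (V \<union> (e - {w})) (V1 \<union> (e1 - {w1}))"
    using b1 b23[unfolded e] by (rule bij_betw_combine) (use 1 in auto)
  moreover have "V \<union> (e - {w}) = V \<union> e" "V1 \<union> (e1 - {w1}) = V'" using rV 1(1) by auto
  ultimately have "bij_betw f' (V \<union> e) V'" by simp
  moreover have "f' r = r'" using rV by (simp add: f'_def)
  moreover have "f' ` e = e1"
  proof -
    have "e = insert w (e - {w})" using path_step.hyps by blast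
    then have "f' ` e = insert (f' w) (f' ` (e - {w}))" by (metis image_insert)
    also have "f' ` (e - {w}) = e1 - {w1}" using b23[unfolded e] by (simp add: bij_betw_def)
    also have "f' w = w1" using rV f(2) by (simp add: f'_def)
    finally show ?thesis using 1 by blast
  qed
  moreover have "(\<lambda>e. f' ` e) ` E = (\<lambda>e. f ` e) ` E"
  proof (rule image_cong[OF refl])
    fix e2 assume "e2 \<in> E"
    then have "e2 \<subseteq> V" using rooted_path_basic(4)[OF path_step.hyps(1) \<open>k \<ge> 2\<close>] by blast
    then show "f' ` e2 = f ` e2" by (intro image_cong) (auto simp: f'_def)
  qed
  ultimately show ?case unfolding 1(2) using f(3) by (intro exI[of _ f']) auto
qed

lemma hyperpath_rooted_path:
  assumes "hyperpath vs es" "\<forall>e\<in>set es. card e = k"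
  shows "rooted_path k (hd vs) (set vs \<union> \<Union>(set es)) (set es)"
  using assms
proof (induction es arbitrary: vs)
  case Nil
  then obtain v where "vs = [v]" by (auto simp: hyperpath_def length_Suc_conv)
  then show ?case by (simp add: path_single)
next
  case (Cons e es)
  then obtain v w ws where vs: "vs = v # w # ws"
    by (auto simp: hyperpath_def length_Suc_conv)
  note hp = Cons.prems(1)[unfolded hyperpath_def vs]
  have hp': "hyperpath (w # ws) es"
    unfolding hyperpath_def
  proof (intro conjI allI impI)
    show "length (w # ws) = length es + 1" "distinct (w # ws)" "distinct es" using hp by auto
    show "(w # ws) ! i \<in> es ! i" "(w # ws) ! (i + 1) \<in> es ! i" if "i < length es" for i
      using hp that by (auto dest!: spec[of _ "Suc i"])
    show "es ! i \<inter> es ! (i + 1) = {(w # ws) ! (i + 1)}" if "i + 1 < length es" for i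
    proof -
      have "Suc i + 1 < length (e # es)" using that by simp
      then have "(e # es) ! Suc i \<inter> (e # es) ! (Suc i + 1) = {(v # w # ws) ! (Suc i + 1)}"
        using hp by blast
      then show ?thesis by simp
    qed
    show "es ! i \<inter> es ! j = {}" if "i < length es \<and> j < length es \<and> i + 2 \<le> j" for i j
    proof -
      have "Suc i < length (e # es) \<and> Suc j < length (e # es) \<and> Suc i + 2 \<le> Suc j" using that by simp
      then have "(e # es) ! Suc i \<inter> (e # es) ! Suc j = {}" using hp by blast
      then show ?thesis by simp
    qed
  qed
  then have IH: "rooted_path k w (set (w # ws) \<union> \<Union>(set es)) (set es)"
    using Cons.IH[of "w # ws"] Cons.prems(2) by simp
  have ve: "v \<in> e" "w \<in> e" using hp by (auto dest!: spec[of _ 0])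
  have vw: "v \<noteq> w" using hp by simp
  have int: "e \<inter> (set (w # ws) \<union> \<Union>(set es)) = {w}"
  proof (cases es)
    case Nil
    then show ?thesis using hp ve by auto
  next
    case es: (Cons e2 es2)
    have i0: "e \<inter> e2 = {w}" using hp es by (auto dest!: spec[of _ 0])
    have i1: "e \<inter> es ! Suc j = {}" if "Suc j < length es" for j
    proof -
      have "0 < length (e # es) \<and> Suc (Suc j) < length (e # es) \<and> 0 + 2 \<le> Suc (Suc j)" using that by simp
      then have "(e # es) ! 0 \<inter> (e # es) ! Suc (Suc j) = {}" using hp by blast
      then show ?thesis by simp
    qed
    have U: "e \<inter> es ! j \<subseteq> {w}" if "j < length es" for j
      using i0 i1 that es by (cases j) auto
    have "set ws \<subseteq> \<Union>(set es)"
    proof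
      fix a assume "a \<in> set ws"
      then obtain i where i: "i < length ws" "a = ws ! i" by (auto simp: in_set_conv_nth)
      then have "i < length es" using hp by simp
      moreover have "(w # ws) ! (i + 1) \<in> es ! i" using hp' calculation by (auto simp: hyperpath_def)
      ultimately show "a \<in> \<Union>(set es)" using i by auto
    qed
    moreover have "e \<inter> \<Union>(set es) \<subseteq> {w}" using U by (fastforce simp: in_set_conv_nth)
    ultimately show ?thesis using ve by auto
  qed
  have "rooted_path k v ((set (w # ws) \<union> \<Union>(set es)) \<union> e) (insert e (set es))"
    using path_step[OF IH _ ve vw int] Cons.prems(2) by simp
  moreover have "(set (w # ws) \<union> \<Union>(set es)) \<union> e = set vs \<union> \<Union>(set (e # es))"
    using ve vs by auto
  ultimately show ?case by (simp add: vs)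
qed

section \<open>Branches of a supertree and the path recurrence\<close>

context path_recurrence
begin

lemma f_nonneg:
  assumes "good n" shows "f n \<ge> 0"
proof -
  have "t n \<le> \<mu> * u n"
    using C_nonneg[OF assms] kappa mu_pos by (simp add: t_def u_def algebra_simps)
  then show ?thesis using assms by (simp add: f_def good_def divide_le_eq)
qed

lemma t_pos: "good n \<Longrightarrow> f n < \<mu> \<Longrightarrow> t n > 0"
  unfolding f_def good_def by (smt (verit) divide_nonpos_pos order_refl)

lemma g_eq: "g n = 1 / (\<mu> - f n)"
  by (simp add: g_def f_def)

lemma g_ge:
  assumes "good n" "t n > 0" shows "g n \<ge> 1 / \<mu>"
proof -
  have "\<mu> - f n > 0" using assms by (simp add: f_def good_def)
  then show ?thesis using f_nonneg[OF assms(1)] mu_pos unfolding g_eq by (simp add: frac_le)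
qed

text \<open>Describes an edge with \<open>\<kappa> + 2\<close> vertices: those in \<open>B\<close>
  carry paths, the others are counted as leaves of share \<open>1 / \<mu>\<close>. Repeated use of
  \<open>g_add_le\<close> gathers all edges at one vertex, and a merge without loss has an empty
  path on one side.\<close>

lemma g_sum_le:
  assumes "finite B" "B \<noteq> {}" "\<And>w. w \<in> B \<Longrightarrow> good (m w) \<and> t (m w) > 0"
    and "(\<Sum>w\<in>B. g (m w)) + (\<kappa> + 2 - real (card B)) / \<mu> < 1"
  shows "good (\<Sum>w\<in>B. m w) \<and> t (\<Sum>w\<in>B. m w) > 0 \<and>
    (real (card B) - 1) / \<mu> + g (\<Sum>w\<in>B. m w) \<le> (\<Sum>w\<in>B. g (m w)) \<and>
    ((real (card B) - 1) / \<mu> + g (\<Sum>w\<in>B. m w) = (\<Sum>w\<in>B. g (m w)) \<longrightarrow>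
      (\<exists>w\<in>B. \<forall>w'\<in>B - {w}. m w' = 0))"
  using assms
proof (induction rule: finite_ne_induct)
  case (insert w B)
  let ?M = "\<Sum>w\<in>B. m w" and ?G = "\<Sum>w\<in>B. g (m w)"
  have w: "good (m w)" "t (m w) > 0" using insert.prems by auto
  have c: "card (insert w B) = Suc (card B)" "(\<Sum>w\<in>insert w B. g (m w)) = g (m w) + ?G"
    "(\<Sum>w\<in>insert w B. m w) = m w + ?M"
    using insert.hyps by simp_all
  have hyp: "g (m w) + ?G + (\<kappa> + 1 - real (card B)) / \<mu> < 1"
    using insert.prems(2) unfolding c by (simp add: add.commute add_diff_eq)
  \<comment> \<open>Dropping \<open>w\<close> from the set counts it as a leaf. This only lowers its
    share, by \<open>g_ge\<close>, so the smallness hypothesis passes to \<open>B\<close>.\<close>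
  have "?G + (\<kappa> + 2 - real (card B)) / \<mu> = 1 / \<mu> + ?G + (\<kappa> + 1 - real (card B)) / \<mu>"
    by (simp add: add_divide_distrib diff_divide_distrib)
  also have "\<dots> < 1" using hyp g_ge[OF w] by simp
  finally have IH: "good ?M" "t ?M > 0" "(real (card B) - 1) / \<mu> + g ?M \<le> ?G"
    "(real (card B) - 1) / \<mu> + g ?M = ?G \<Longrightarrow> \<exists>w\<in>B. \<forall>w'\<in>B - {w}. m w' = 0"
    using insert.IH insert.prems(1) by auto
  have "(\<kappa> + 1 - real (card B)) / \<mu> + (real (card B) - 1) / \<mu> = \<kappa> / \<mu>"
    by (simp add: add_divide_distrib[symmetric])
  then have "\<kappa> / \<mu> + g (m w) + g ?M < 1" using hyp IH(3) by linarith
  note merge = g_add_le[OF w(1) IH(1) w(2) IH(2) this]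
  have d: "(real (card B)) / \<mu> = (real (card B) - 1) / \<mu> + 1 / \<mu>"
    by (simp add: add_divide_distrib[symmetric])
  have le: "real (card B) / \<mu> + g (m w + ?M) \<le> g (m w) + ?G"
    using merge(3) IH(3) d by linarith
  have eq: "\<exists>w'\<in>insert w B. \<forall>w''\<in>insert w B - {w'}. m w'' = 0"
    if "real (card B) / \<mu> + g (m w + ?M) = g (m w) + ?G"
  proof -
    have "(real (card B) - 1) / \<mu> + g ?M = ?G" "\<not> 1 / \<mu> + g (m w + ?M) < g (m w) + g ?M"
      using that merge(3) IH(3) d by linarith+
    then have "\<exists>w\<in>B. \<forall>w'\<in>B - {w}. m w' = 0" "m w = 0 \<or> ?M = 0"
      using IH(4) merge(4) by force+
    moreover have "\<forall>w\<in>B. m w = 0" if "?M = 0" using that insert.hyps(1) by simp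
    ultimately show ?thesis by blast
  qed
  show ?case unfolding c using merge(1,2) le eq by simp
qed (auto simp: g_def)

text \<open>At \<open>w \<noteq> r\<close> in the root edge, of sum \<open>S\<close>, the
  eigenvector equation says that the share \<open>x w / S\<close> equals
  \<open>1 / (\<mu> - F w)\<close>, so the induction hypothesis bounds it below by \<open>g\<close>.
  Gathering these paths at one vertex leaves the root a larger share, that is, a smaller
  contribution of this edge; \<open>f_add_le\<close> then merges it with the branch grafted at
  \<open>r\<close> itself.\<close>

lemma rooted_supertree_bound:
  assumes k: "real k = \<kappa> + 2" and "rooted_supertree k r V E" "\<forall>v\<in>V. x v > 0"
    and "\<forall>v\<in>V - {r}. flow E x v = (\<mu> - 1) * x v" "flow E x r < (\<mu> - 1) * x r"
  shows "good (card E) \<and> f (card E) \<le> flow E x r / x r \<and>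
    (f (card E) = flow E x r / x r \<longrightarrow> rooted_path k r V E)"
  using assms(2-)
proof (induction rule: rooted_supertree.induct)
  case (single r)
  then show ?case by (simp add: flow_def path_single)
next
  case (graft e r Vf Ef)
  have k2: "k \<ge> 2" using k kappa by linarith
  have rt: "\<forall>w\<in>e. rooted_supertree k w (Vf w) (Ef w)" using graft.IH by blast
  note gf = graft_facts[OF k2 graft.hyps(1) rt graft.hyps(3)]
  note basic = rooted_supertree_basic[OF rt[rule_format] k2]
  define E' where "E' = insert e (\<Union>w\<in>e. Ef w)"
  define S where "S = sum x e"
  define m where "m w = card (Ef w)" for w
  define F where "F w = flow (Ef w) x w / x w" for w
  define B where "B = e - {r}"
  define M where "M = (\<Sum>w\<in>B. m w)"
  have fl: "flow E' x v = (if v = w then sum x e - x v + flow (Ef w) x v else flow (Ef w) x v)"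
    if "w \<in> e" "v \<in> Vf w" for w v
    unfolding E'_def using k2 graft.hyps(1) rt graft.hyps(3) that by (rule flow_graft)
  note prems = graft.prems[folded E'_def]
  have cardB: "real (card B) = \<kappa> + 1" "finite B" "B \<noteq> {}"
  proof -
    have "card B = k - 1" unfolding B_def using graft.hyps gf(1) by simp
    then show "real (card B) = \<kappa> + 1" "finite B" using k k2 gf(1) B_def by auto
    then show "B \<noteq> {}" using kappa by auto
  qed
  have xpos: "x w > 0" if "w \<in> e" for w using prems(1) basic(3) that by blast
  have Spos: "S > x w" if w: "w \<in> e" for w
  proof -
    have "S = x w + sum x (e - {w})" unfolding S_def using gf(1) w by (simp add: sum.remove)
    moreover have "e - {w} \<noteq> {}" using graft.hyps(1) k2 w
      by (metis One_nat_def card.empty card_Suc_Diff1 gf(1) not_less_eq_eq numeral_2_eq_2 order_refl)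
    then have "sum x (e - {w}) > 0" using gf(1) xpos by (intro sum_pos) auto
    ultimately show ?thesis by simp
  qed
  have S0: "S > 0" using Spos[OF graft.hyps(2)] xpos[OF graft.hyps(2)] by simp
  have flw: "flow E' x w = S - x w + flow (Ef w) x w" if "w \<in> e" for w
    using fl[OF that basic(3)[OF that]] by (simp add: S_def)
  have flB: "flow (Ef w) x w = \<mu> * x w - S" if w: "w \<in> B" for w
  proof -
    have "w \<in> (\<Union>w\<in>e. Vf w) - {r}" using w basic(3) unfolding B_def by blast
    then show ?thesis using prems(2) flw[of w] w by (auto simp: B_def algebra_simps)
  qed
  have FB: "F w = \<mu> - S / x w" if "w \<in> B" for w
    using flB[OF that] xpos[of w] that by (simp add: F_def B_def diff_divide_distrib)
  \<comment> \<open>Every branch inherits the strict hypothesis, since at its root the edge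
    \<open>e\<close> alone contributes \<open>S - x w > 0\<close>.\<close>
  have less: "flow (Ef w) x w < (\<mu> - 1) * x w" if w: "w \<in> e" for w
  proof (cases "w = r")
    case True
    then show ?thesis using prems(3) flw[OF w] Spos[OF w] by simp
  next
    case False
    then show ?thesis using flB[of w] Spos[OF w] w by (simp add: B_def algebra_simps)
  qed
  have IH: "good (m w)" "f (m w) \<le> F w" "f (m w) = F w \<Longrightarrow> rooted_path k w (Vf w) (Ef w)"
    if w: "w \<in> e" for w
  proof -
    have "flow (Ef w) x v = (\<mu> - 1) * x v" if v: "v \<in> Vf w - {w}" for v
    proof -
      have "v \<noteq> r" using v gf(2)[OF w] graft.hyps(2) by blast
      then have "flow E' x v = (\<mu> - 1) * x v" using prems(2) v w by blast
      then show ?thesis using fl[OF w, of v] v by simp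
    qed
    then show "good (m w)" "f (m w) \<le> F w" "f (m w) = F w \<Longrightarrow> rooted_path k w (Vf w) (Ef w)"
      using graft.IH[rule_format, OF w] prems(1) w less[OF w] unfolding m_def F_def by auto
  qed
  have Fless: "F w < \<mu> - 1" if "w \<in> e" for w
    using less[OF that] xpos[OF that] by (simp add: F_def divide_less_eq)
  have tpos: "t (m w) > 0" if "w \<in> e" for w
    using t_pos[OF IH(1)[OF that]] IH(2)[OF that] Fless[OF that] by linarith
  have g_le: "g (m w) \<le> x w / S" if w: "w \<in> B" for w
  proof -
    have we: "w \<in> e" using w B_def by simp
    have "g (m w) \<le> 1 / (\<mu> - F w)"
      unfolding g_eq using IH(2)[OF we] Fless[OF we] by (intro frac_le) auto
    then show ?thesis using FB[OF w] by simp
  qed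
  have g_eqF: "f (m w) = F w" if w: "w \<in> B" and "g (m w) = x w / S" for w
  proof -
    have we: "w \<in> e" using w B_def by simp
    have "1 / (\<mu> - f (m w)) = 1 / (\<mu> - F w)" using that FB[OF w] by (simp add: g_eq)
    then show ?thesis by (metis add_diff_cancel_left' diff_add_cancel div_by_1 divide_divide_eq_right mult_1 right_minus_eq)
  qed
  have sumB: "(\<Sum>w\<in>B. x w / S) = 1 - x r / S"
  proof -
    have "S = x r + sum x B" unfolding S_def B_def using gf(1) graft.hyps(2) by (simp add: sum.remove)
    then show ?thesis using S0 by (simp add: sum_divide_distrib[symmetric] field_simps)
  qed
  have xr: "x r > 0" using xpos graft.hyps(2) .
  have Ftot: "flow E' x r / x r = F r + (S / x r - 1)"
    using flw[OF graft.hyps(2)] xr by (simp add: F_def add_divide_distrib diff_divide_distrib)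
  have Ftot_less: "flow E' x r / x r < \<mu> - 1" using prems(3) xr by (simp add: divide_less_eq)
  have "F r \<ge> 0" using f_nonneg[OF IH(1)] IH(2) graft.hyps(2) by force
  then have "S / x r < \<mu>" using Ftot Ftot_less by simp
  \<comment> \<open>The slack at the root gives it a larger share than a leaf, so
    \<open>g_sum_le\<close> applies with \<open>r\<close> counted as a leaf.\<close>
  then have xrS: "1 / \<mu> < x r / S" using xr S0 mu_pos by (simp add: field_simps)
  have sum_le: "(\<Sum>w\<in>B. g (m w)) \<le> 1 - x r / S"
    unfolding sumB[symmetric] by (rule sum_mono) (rule g_le)
  have "(\<kappa> + 2 - real (card B)) / \<mu> = 1 / \<mu>" unfolding cardB(1) by simp
  then have hsum: "(\<Sum>w\<in>B. g (m w)) + (\<kappa> + 2 - real (card B)) / \<mu> < 1"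
    using xrS sum_le by linarith
  have hB: "good (m w) \<and> t (m w) > 0" if "w \<in> B" for w
    using IH(1) tpos that unfolding B_def by blast
  have hc: "(real (card B) - 1) / \<mu> = \<kappa> / \<mu>" unfolding cardB(1) by simp
  note gs0 = g_sum_le[OF cardB(2,3), of m, OF _ hsum, unfolded hc, folded M_def]
  have gs: "good M" "t M > 0" "\<kappa> / \<mu> + g M \<le> (\<Sum>w\<in>B. g (m w))"
    "\<kappa> / \<mu> + g M = (\<Sum>w\<in>B. g (m w)) \<Longrightarrow> \<exists>w\<in>B. \<forall>w'\<in>B - {w}. m w' = 0"
    using gs0 hB by blast+
  \<comment> \<open>This is the root's share once all \<open>M\<close> edges hang from a single
    other vertex of \<open>e\<close>.\<close>
  have uM: "u (Suc M) / t M = 1 - \<kappa> / \<mu> - g M"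
    using alpha_t[of M] gs(2) unfolding g_def by (simp add: field_simps)
  have ge: "u (Suc M) / t M \<ge> x r / S" using uM gs(3) sum_le by linarith
  then have "u (Suc M) / t M > 0" using xr S0 by (smt (verit) divide_pos_pos)
  then have uMpos: "u (Suc M) > 0" using gs(2) by (simp add: zero_less_divide_iff)
  then have goodM: "good (Suc M)" using gs(1) by (auto simp: good_def le_Suc_eq)
  have fM: "f (Suc M) = t M / u (Suc M) - 1"
    unfolding f_def using t_add_t_Suc[of M] uMpos by (simp add: field_simps)
  have "t M / u (Suc M) \<le> S / x r"
    using ge uMpos gs(2) xr S0 by (simp add: field_simps)
  then have fM_le: "f (Suc M) \<le> S / x r - 1" using fM by simp
  have mr: "good (m r)" "f (m r) \<le> F r" using IH graft.hyps(2) by auto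
  have le: "f (m r) + f (Suc M) \<le> flow E' x r / x r" using fM_le mr Ftot by linarith
  note add = f_add_le[OF mr(1) goodM, OF order_le_less_trans[OF le Ftot_less]]
  have cardE: "card E' = m r + Suc M"
    unfolding E'_def gf(5) M_def B_def m_def using gf(1) graft.hyps(2) by (simp add: sum.remove)
  \<comment> \<open>Equality makes every merge lossless: no edges are grafted at \<open>r\<close>,
    at most one vertex \<open>w0\<close> of \<open>B\<close> carries edges, and its share is tight,
    so its branch is a path by induction.\<close>
  have "rooted_path k r (\<Union>w\<in>e. Vf w) E'" if eq: "f (card E') = flow E' x r / x r"
  proof -
    have 1: "f (m r + Suc M) = f (m r) + f (Suc M)" and 2: "f (Suc M) = S / x r - 1"
      using eq add(2) le fM_le mr(2) Ftot unfolding cardE by linarith+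
    have mr0: "m r = 0" using add(3) 1 by fastforce
    have "t M / u (Suc M) = S / x r" using fM 2 by simp
    then have "u (Suc M) / t M = x r / S" by (metis inverse_divide)
    then have tight: "\<kappa> / \<mu> + g M = (\<Sum>w\<in>B. g (m w))" "(\<Sum>w\<in>B. g (m w)) = (\<Sum>w\<in>B. x w / S)"
      using uM gs(3) sum_le sumB by linarith+
    obtain w0 where w0: "w0 \<in> B" "\<forall>w\<in>B - {w0}. m w = 0" using gs(4)[OF tight(1)] by blast
    have "g (m w0) = x w0 / S"
    proof (rule ccontr)
      assume "g (m w0) \<noteq> x w0 / S"
      then have "g (m w0) < x w0 / S" using g_le[OF w0(1)] by simp
      then have "(\<Sum>w\<in>B. g (m w)) < (\<Sum>w\<in>B. x w / S)"
        using g_le w0(1) cardB(2) by (intro sum_strict_mono_ex1) auto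
      then show False using tight(2) by simp
    qed
    then have rp: "rooted_path k w0 (Vf w0) (Ef w0)" using g_eqF IH(3) w0(1) B_def by auto
    have triv: "Ef w = {}" "Vf w = {w}" if w: "w \<in> e" "w \<noteq> w0" for w
    proof -
      have "m w = 0" using w mr0 w0(2) by (cases "w = r") (auto simp: B_def)
      then show "Ef w = {}" using basic(2)[OF w(1)] by (simp add: m_def)
      then show "Vf w = {w}" using rooted_supertree_trivial[OF rt[rule_format, OF w(1)]] by simp
    qed
    have w0e: "w0 \<in> e" "r \<noteq> w0" using w0(1) B_def by auto
    have e: "e = insert w0 (e - {w0})" using w0e by blast
    have "(\<Union>w\<in>e - {w0}. Ef w) = {}" "(\<Union>w\<in>e - {w0}. Vf w) = e - {w0}" using triv by auto
    then have "(\<Union>w\<in>e. Ef w) = Ef w0" "(\<Union>w\<in>e. Vf w) = Vf w0 \<union> (e - {w0})"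
      by (metis UN_insert e sup_bot.right_neutral)+
    moreover have "Vf w0 \<union> (e - {w0}) = Vf w0 \<union> e" using basic(3)[OF w0e(1)] by blast
    moreover have "rooted_path k r (Vf w0 \<union> e) (insert e (Ef w0))"
      using path_step[OF rp graft.hyps(1,2) w0e(1,2)] gf(2)[OF w0e(1)] by blast
    ultimately show ?thesis by (simp add: E'_def)
  qed
  then show ?case using add(1,2) le unfolding E'_def[symmetric] cardE by auto
qed

text \<open>Solves the equations starting with entry 1 at the far end. Only the root equation may
  fail, and there \<open>(\<mu> - 1) * z r - flow E z r\<close> is \<open>t - u\<close> at
  \<open>card E\<close>.\<close>

lemma rooted_path_vector:
  assumes k: "real k = \<kappa> + 2" and "rooted_path k r V E" "good (card E)"
  shows "\<exists>z. (\<forall>v\<in>V. z v > 0) \<and> z r = u (card E) \<and> (\<forall>v\<in>V - {r}. flow E z v = (\<mu> - 1) * z v) \<and>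
    flow E z r = \<mu> * u (card E) - t (card E)"
  using assms(2-)
proof (induction rule: rooted_path.induct)
  case (path_single r)
  then show ?case by (intro exI[of _ "\<lambda>_. 1"]) (simp add: flow_def)
next
  case (path_step w V E e r)
  have k2: "k \<ge> 2" using k kappa by linarith
  note facts = rooted_path_step_facts[OF path_step.hyps k2]
  note basic = rooted_path_basic[OF path_step.hyps(1) k2]
  define m where "m = card E"
  have good: "good (Suc m)" using path_step.prems facts(3) m_def by simp
  then have gm: "good m" by (simp add: good_def)
  have um: "u m > 0" "u (Suc m) > 0" using good by (simp_all add: good_def)
  have tm: "t m > 0" using alpha_t[of m] um alpha_pos by (metis add_pos_pos zero_less_mult_pos)
  obtain z where z: "\<forall>v\<in>V. z v > 0" "z w = u m" "\<forall>v\<in>V - {w}. flow E z v = (\<mu> - 1) * z v"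
    "flow E z w = \<mu> * u m - t m"
    using path_step.IH gm unfolding m_def by blast
  define z' where "z' v = (if v \<in> V then z v else if v = r then u (Suc m) else t m / \<mu>)" for v
  have wr: "w \<in> V" "r \<notin> V" using path_step.hyps by auto
  have z'w: "z' w = u m" "z' r = u (Suc m)" using wr z(2) by (simp_all add: z'_def)
  have inner: "z' v = t m / \<mu>" if "v \<in> e - {w, r}" for v
    using that path_step.hyps by (auto simp: z'_def)
  have S: "sum z' e = t m"
  proof -
    have "e = insert w (insert r (e - {w, r}))" using path_step.hyps by auto
    then have "sum z' e = sum z' (insert w (insert r (e - {w, r})))" by simp
    also have "\<dots> = z' w + (z' r + sum z' (e - {w, r}))"
      using facts(1) path_step.hyps by (subst sum.insert; simp)+
    also have "sum z' (e - {w, r}) = (\<Sum>v\<in>e - {w, r}. t m / \<mu>)"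
      by (rule sum.cong[OF refl inner])
    also have "\<dots> = \<kappa> * (t m / \<mu>)"
    proof -
      have "card (e - {w, r}) = k - 2" using facts(1) path_step.hyps by (simp add: card_Diff_subset)
      then have "real (card (e - {w, r})) = \<kappa>" using k k2 by (simp add: of_nat_diff)
      then show ?thesis by simp
    qed
    finally show ?thesis using z'w alpha_t[of m] by (simp add: algebra_simps)
  qed
  have flowE: "flow E z' v = flow E z v" if "v \<in> V" for v
    unfolding flow_def
  proof (rule sum.cong[OF refl])
    fix e' assume "e' \<in> {e \<in> E. v \<in> e}"
    then have "e' \<subseteq> V" using basic(4) by blast
    then have "sum z' e' = sum z e'" by (intro sum.cong) (auto simp: z'_def)
    then show "sum z' e' - z' v = sum z e' - z v" using that by (simp add: z'_def)
  qed
  have pos: "\<forall>v\<in>V \<union> e. z' v > 0" using z(1) um tm mu_pos by (simp add: z'_def)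
  have "flow (insert e E) z' v = (\<mu> - 1) * z' v" if v: "v \<in> V \<union> e - {r}" for v
  proof (cases "v \<in> V")
    case True
    have zv: "z' v = z v" using True by (simp add: z'_def)
    show ?thesis
    proof (cases "v = w")
      case True
      then show ?thesis using facts(4)[OF \<open>v \<in> V\<close>, of z'] flowE[OF \<open>v \<in> V\<close>] z(4) S z'w
        by (simp add: algebra_simps)
    next
      case False
      then show ?thesis using facts(4)[OF \<open>v \<in> V\<close>, of z'] flowE[OF \<open>v \<in> V\<close>] z(3) zv True by simp
    qed
  next
    case False
    then have v': "v \<in> e - {w}" "v \<in> e - {w, r}" using v wr by auto
    show ?thesis using facts(5)[OF v'(1), of z'] S inner[OF v'(2)] mu_pos
      by (simp add: left_diff_distrib diff_divide_distrib)
  qed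
  moreover have "flow (insert e E) z' r = \<mu> * u (Suc m) - t (Suc m)"
    using facts(5)[of r z'] path_step.hyps S z'w t_add_t_Suc[of m] by (simp add: algebra_simps)
  ultimately show ?case unfolding facts(3) m_def[symmetric] using pos z'w by blast
qed

end

section \<open>Decomposition of a supertree at an edge\<close>

definition walk :: "'a set set \<Rightarrow> nat \<Rightarrow> (nat \<Rightarrow> 'a) \<Rightarrow> (nat \<Rightarrow> 'a set) \<Rightarrow> bool" where
  "walk E l v d \<longleftrightarrow> (\<forall>i<l. d i \<in> E \<and> v i \<in> d i \<and> v (Suc i) \<in> d i)"

lemma walk_exists:
  assumes "(a, b) \<in> (joined E)\<^sup>*"
  shows "\<exists>l v d. walk E l v d \<and> v 0 = a \<and> v l = b"
  using assms
proof (induction rule: rtrancl_induct)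
  case base
  then show ?case by (intro exI[of _ 0] exI[of _ "\<lambda>_. a"]) (simp add: walk_def)
next
  case (step y z)
  then obtain l v d e where "walk E l v d" "v 0 = a" "v l = y" "e \<in> E" "y \<in> e" "z \<in> e" by auto
  then show ?case
    by (intro exI[of _ "Suc l"] exI[of _ "v(Suc l := z)"] exI[of _ "d(l := e)"])
      (auto simp: walk_def less_Suc_eq)
qed

text \<open>One condition covers both kinds of repetition: for \<open>j < l\<close>, each of
  \<open>v i = v j\<close> and \<open>d i = d j\<close> puts \<open>v i\<close> into
  \<open>d j\<close>. The last vertex needs its own case because no edge leaves it.\<close>

lemma walk_shortcut:
  assumes "walk E l v d" "i < j" "j < l \<and> v i \<in> d j \<or> j = l \<and> v i = v l"
  shows "\<exists>v' d'. walk E (l - (j - i)) v' d' \<and> v' 0 = v 0 \<and> v' (l - (j - i)) = v l"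
proof -
  define v' where "v' n = (if n \<le> i then v n else v (n + (j - i)))" for n
  define d' where "d' n = (if n < i then d n else d (n + (j - i)))" for n
  have "d' n \<in> E \<and> v' n \<in> d' n \<and> v' (Suc n) \<in> d' n" if n: "n < l - (j - i)" for n
  proof -
    consider "n < i" | "n = i" | "n > i" by linarith
    then show ?thesis
    proof cases
      case 1
      then show ?thesis using assms n by (auto simp: v'_def d'_def walk_def)
    next
      case 2
      then have "j < l" using n assms by linarith
      moreover have "i + (j - i) = j" "Suc i + (j - i) = Suc j" using assms(2) by simp_all
      ultimately show ?thesis using assms 2 by (auto simp: v'_def d'_def walk_def)
    next
      case 3
      moreover have "n + (j - i) < l" using n by simp
      ultimately show ?thesis using assms(1) by (auto simp: v'_def d'_def walk_def)
    qed
  qed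
  moreover have "v' 0 = v 0" by (simp add: v'_def)
  moreover have "v' (l - (j - i)) = v l"
    using assms(2,3) by (auto simp: v'_def)
  ultimately show ?thesis unfolding walk_def by blast
qed

text \<open>A shortest walk repeats neither a vertex nor an edge, so together with an edge
  through both of its ends it is a Berge cycle.\<close>
lemma berge_cycle_if_joined:
  assumes e: "e \<in> E" "a \<in> e" "b \<in> e" "a \<noteq> b" and "(a, b) \<in> (joined (E - {e}))\<^sup>*"
  shows "has_berge_cycle E"
proof -
  let ?P = "\<lambda>l. \<exists>v d. walk (E - {e}) l v d \<and> v 0 = a \<and> v l = b"
  define l where "l = (LEAST l. ?P l)"
  have "?P l" unfolding l_def using walk_exists[OF assms(5)] by (rule LeastI_ex)
  then obtain v d where w: "walk (E - {e}) l v d" and v0: "v 0 = a" and vl: "v l = b" by blast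
  have no_short: False if "i < j" "j < l \<and> v i \<in> d j \<or> j = l \<and> v i = v l" for i j
  proof -
    have "?P (l - (j - i))" using walk_shortcut[OF w that] v0 vl by simp
    then have "l \<le> l - (j - i)" unfolding l_def by (rule Least_le)
    then show False using that by linarith
  qed
  have l0: "l > 0" using v0 vl e(4) by (cases l) auto
  have W: "d i \<in> E - {e}" "v i \<in> d i" "v (Suc i) \<in> d i" if "i < l" for i
    using w that by (auto simp: walk_def)
  have vneq: "v i \<noteq> v j" if "i < j" "j \<le> l" for i j
    using no_short[OF that(1)] W(2)[of j] that by (metis le_neq_implies_less)
  have inj_v: "inj_on v {..l}"
    by (rule linorder_inj_onI') (use vneq in auto)
  have dneq: "d i \<noteq> d j" if "i < j" "j < l" for i j
    using no_short[OF that(1)] W(2)[of i] that by auto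
  have inj_d: "inj_on d {..<l}"
    by (rule linorder_inj_onI') (use dneq in auto)
  define vs where "vs = map v [0..<Suc l]"
  define es where "es = map d [0..<l] @ [e]"
  have len: "length vs = Suc l" "length es = Suc l" by (simp_all add: vs_def es_def)
  have vsn: "vs ! i = v i" if "i \<le> l" for i using that by (simp add: vs_def del: upt_Suc)
  have esn: "es ! i = (if i < l then d i else e)" if "i \<le> l" for i
    using that by (auto simp: es_def nth_append)
  have "distinct vs" unfolding vs_def distinct_map using inj_v
    by (simp add: atLeast0LessThan lessThan_Suc_atMost del: upt_Suc)
  moreover have "distinct es" unfolding es_def using inj_d W(1)
    by (auto simp: distinct_map atLeast0LessThan)
  moreover have "set es \<subseteq> E" using W(1) e(1) by (auto simp: es_def)
  moreover have "vs ! i \<in> es ! i \<and> vs ! ((i + 1) mod length vs) \<in> es ! i" if i: "i < length vs" for i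
  proof (cases "i < l")
    case True
    then have "(i + 1) mod length vs = Suc i" by (simp add: len)
    then show ?thesis using True W[OF True] by (simp add: vsn esn)
  next
    case False
    then have "i = l" using i len by simp
    then show ?thesis using vsn[of l] vsn[of 0] esn[of l] v0 vl e by (simp add: len)
  qed
  ultimately show ?thesis unfolding has_berge_cycle_def using l0 len by (intro exI[of _ vs] exI[of _ es]) auto
qed

text \<open>The parts are the connected components after deleting \<open>e\<close>. Two vertices of
  \<open>e\<close> in one component would close a Berge cycle through \<open>e\<close>; every vertex
  is reached because a use of \<open>e\<close> can be replaced by starting at another of its
  vertices.\<close>

lemma supertree_split:
  assumes "supertree V E" "e \<in> E"
  obtains Vf Ef where "\<And>w. w \<in> e \<Longrightarrow> supertree (Vf w) (Ef w) \<and> w \<in> Vf w \<and> Ef w \<subseteq> E - {e}"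
    "disjoint_family_on Vf e" "V = (\<Union>w\<in>e. Vf w)" "E = insert e (\<Union>w\<in>e. Ef w)"
proof -
  have hg: "finite V" "V \<noteq> {}" "\<And>e. e \<in> E \<Longrightarrow> e \<subseteq> V \<and> card e \<ge> 2"
    and con: "connected_hg V E" and acyc: "\<not> has_berge_cycle E"
    using assms(1) by (auto simp: supertree_def hypergraph_def)
  define R where "R = joined (E - {e})"
  define Vf where "Vf w = {v \<in> V. (w, v) \<in> R\<^sup>*}" for w
  define Ef where "Ef w = {e' \<in> E - {e}. e' \<subseteq> Vf w}" for w
  have eV: "e \<subseteq> V" using hg assms(2) by blast
  have nonempty: "\<exists>v. v \<in> e'" if "e' \<in> E" for e' using hg(3)[OF that]
    by (metis card.empty ex_in_conv not_numeral_le_zero)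
  have edge_in: "e' \<subseteq> Vf w" if "e' \<in> E - {e}" "v \<in> e'" "v \<in> Vf w" for e' v w
  proof
    fix v' assume "v' \<in> e'"
    then have "(v, v') \<in> R" using that unfolding R_def by blast
    moreover have "v' \<in> V" using \<open>v' \<in> e'\<close> hg(3) that(1) by blast
    ultimately show "v' \<in> Vf w" using that(3) unfolding Vf_def by (auto intro: rtrancl_into_rtrancl)
  qed
  have 1: "supertree (Vf w) (Ef w) \<and> w \<in> Vf w \<and> Ef w \<subseteq> E - {e}" if w: "w \<in> e" for w
  proof -
    have wV: "w \<in> Vf w" using w eV by (auto simp: Vf_def)
    have "hypergraph (Vf w) (Ef w)"
      unfolding hypergraph_def using wV hg by (auto simp: Vf_def Ef_def)
    moreover have "(w, v) \<in> (joined (Ef w))\<^sup>*" if "(w, v) \<in> R\<^sup>*" for v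
      using that
    proof (induction rule: rtrancl_induct)
      case (step y z)
      then obtain e' where e': "e' \<in> E - {e}" "y \<in> e'" "z \<in> e'" by (auto simp: R_def)
      then have "y \<in> Vf w" using step(1) hg(3) by (auto simp: Vf_def)
      then have "e' \<in> Ef w" using edge_in e' by (auto simp: Ef_def)
      then have "(y, z) \<in> joined (Ef w)" using e' by blast
      then show ?case using step.IH by (rule rtrancl_into_rtrancl[rotated])
    qed simp
    then have "connected_hg (Vf w) (Ef w)"
      by (intro connected_hg_if_root[of _ w]) (simp add: Vf_def)
    moreover have "\<not> has_berge_cycle (Ef w)"
    proof
      assume "has_berge_cycle (Ef w)"
      then have "has_berge_cycle E" unfolding has_berge_cycle_def Ef_def by blast
      then show False using acyc by simp
    qed
    ultimately show ?thesis using wV by (auto simp: supertree_def Ef_def)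
  qed
  have 2: "disjoint_family_on Vf e"
    unfolding disjoint_family_on_def
  proof (intro ballI impI)
    fix w w' assume w: "w \<in> e" "w' \<in> e" "w \<noteq> w'"
    show "Vf w \<inter> Vf w' = {}"
    proof (rule ccontr)
      assume "Vf w \<inter> Vf w' \<noteq> {}"
      then obtain v where "(w, v) \<in> R\<^sup>*" "(w', v) \<in> R\<^sup>*" by (auto simp: Vf_def)
      then have "(w, w') \<in> R\<^sup>*" unfolding R_def by (rule rtrancl_trans[OF _ joined_sym])
      then show False using berge_cycle_if_joined[OF assms(2) w] acyc unfolding R_def by blast
    qed
  qed
  have cover: "\<exists>w\<in>e. v \<in> Vf w" if v: "v \<in> V" for v
  proof -
    obtain r where r: "r \<in> e" using nonempty assms(2) by blast
    have "(r, v) \<in> (joined E)\<^sup>*" using con v r eV unfolding connected_hg_def by blast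
    then have "\<exists>w\<in>e. (w, v) \<in> R\<^sup>*"
    proof (induction rule: rtrancl_induct)
      case base
      then show ?case using r by blast
    next
      case (step y z)
      then obtain e' where e': "e' \<in> E" "y \<in> e'" "z \<in> e'" by blast
      show ?case
      proof (cases "e' = e")
        case True
        then show ?thesis using e' by blast
      next
        case False
        then have "(y, z) \<in> R" using e' by (auto simp: R_def)
        then show ?thesis using step.IH by (meson rtrancl_into_rtrancl)
      qed
    qed
    then show ?thesis using v by (auto simp: Vf_def)
  qed
  have 3: "V = (\<Union>w\<in>e. Vf w)" using cover by (auto simp: Vf_def)
  have "e' \<in> (\<Union>w\<in>e. Ef w)" if e': "e' \<in> E" "e' \<noteq> e" for e'
  proof -
    obtain v where "v \<in> e'" using nonempty e' by blast
    then obtain w where w: "w \<in> e" "e' \<subseteq> Vf w"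
      using cover[of v] hg(3)[OF e'(1)] edge_in[of e' v] e' by blast
    then have "e' \<in> Ef w" using e' by (simp add: Ef_def)
    then show ?thesis using w by blast
  qed
  then have 4: "E = insert e (\<Union>w\<in>e. Ef w)" using assms(2) by (auto simp: Ef_def)
  show ?thesis using that[OF 1 2 3 4] by blast
qed

text \<open>Splits at any edge through \<open>r\<close>. Further edges at \<open>r\<close> stay in
  the component of \<open>r\<close>, which has fewer edges and is grafted at
  \<open>r\<close>.\<close>

lemma supertree_rooted:
  assumes "supertree V E" "k_uniform k E" "r \<in> V"
  shows "rooted_supertree k r V E"
  using assms
proof (induction "card E" arbitrary: r V E rule: less_induct)
  case less
  have fin: "finite E" using less.prems(1) unfolding supertree_def hypergraph_def
    by (meson Pow_iff finite_Pow_iff rev_finite_subset subsetI)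
  have con: "(r, v) \<in> (joined E)\<^sup>*" if "v \<in> V" for v
    using less.prems that by (auto simp: supertree_def connected_hg_def)
  show ?case
  proof (cases "E = {}")
    case True
    have "v = r" if "v \<in> V" for v using con[OF that] True by simp
    then have "V = {r}" using less.prems(3) by blast
    then show ?thesis using True by (simp add: single)
  next
    case False
    then obtain e0 where e0: "e0 \<in> E" by blast
    then have "e0 \<subseteq> V" "card e0 \<ge> 2" using less.prems(1) by (auto simp: supertree_def hypergraph_def)
    then obtain v where v: "v \<in> e0" "v \<in> V"
      by (metis card.empty ex_in_conv not_numeral_le_zero subsetD)
    have "\<exists>e\<in>E. r \<in> e"
      using con[OF v(2)] e0 v by (cases rule: converse_rtranclE) auto
    then obtain e where e: "e \<in> E" "r \<in> e" by blast
    obtain Vf Ef where s: "\<And>w. w \<in> e \<Longrightarrow> supertree (Vf w) (Ef w) \<and> w \<in> Vf w \<and> Ef w \<subseteq> E - {e}"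
      "disjoint_family_on Vf e" "V = (\<Union>w\<in>e. Vf w)" "E = insert e (\<Union>w\<in>e. Ef w)"
      using supertree_split[OF less.prems(1) e(1)] by blast
    have "rooted_supertree k w (Vf w) (Ef w)" if w: "w \<in> e" for w
    proof (rule less.hyps)
      show "card (Ef w) < card E" using s(1)[OF w] e(1) fin by (intro psubset_card_mono) auto
      show "k_uniform k (Ef w)" using s(1)[OF w] less.prems(2) by (auto simp: k_uniform_def)
    qed (use s(1)[OF w] in auto)
    moreover have "card e = k" using e(1) less.prems(2) by (simp add: k_uniform_def)
    ultimately show ?thesis unfolding s(3) using graft[of e k r Vf Ef] e(2) s(2) s(4) by simp
  qed
qed

lemma supertree_pendant_split:
  assumes "supertree V E" "k_uniform k E" "E \<noteq> {}" "k \<ge> 2"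
  obtains e w Vf Ef where "w \<in> e" "card e = k"
    "\<forall>v\<in>e. rooted_supertree k v (Vf v) (Ef v)" "disjoint_family_on Vf e"
    "V = (\<Union>w\<in>e. Vf w)" "E = insert e (\<Union>w\<in>e. Ef w)"
    "\<forall>v\<in>e - {w}. Ef v = {} \<and> Vf v = {v}"
proof -
  obtain r where r: "r \<in> V" using assms(1) by (auto simp: supertree_def hypergraph_def)
  obtain e w where e: "e \<in> E" "w \<in> e" "\<And>v e'. v \<in> e - {w} \<Longrightarrow> e' \<in> E \<Longrightarrow> v \<in> e' \<Longrightarrow> e' = e"
    using pendant_edge_exists[OF supertree_rooted[OF assms(1,2) r] assms(4,3)] by blast
  obtain Vf Ef where s: "\<And>w. w \<in> e \<Longrightarrow> supertree (Vf w) (Ef w) \<and> w \<in> Vf w \<and> Ef w \<subseteq> E - {e}"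
      "disjoint_family_on Vf e" "V = (\<Union>w\<in>e. Vf w)" "E = insert e (\<Union>w\<in>e. Ef w)"
    using supertree_split[OF assms(1) e(1)] by blast
  have rt: "rooted_supertree k v (Vf v) (Ef v)" if v: "v \<in> e" for v
    using s(1)[OF v] assms(2) by (intro supertree_rooted) (auto simp: k_uniform_def)
  have "Ef v = {} \<and> Vf v = {v}" if v: "v \<in> e" "v \<noteq> w" for v
  proof -
    have "Ef v = {}"
    proof (rule ccontr)
      assume "Ef v \<noteq> {}"
      then obtain e' where "e' \<in> Ef v" "v \<in> e'" using rooted_supertree_root_edge[OF rt[OF v(1)]] by blast
      then show False using e(3)[of v e'] s(1)[OF v(1)] v by blast
    qed
    then show ?thesis using rooted_supertree_trivial[OF rt[OF v(1)]] by blast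
  qed
  moreover have "card e = k" using e(1) assms(2) by (simp add: k_uniform_def)
  ultimately show ?thesis using that[of w e Vf Ef, OF e(2) _ _ s(2-4)] rt by simp
qed

section \<open>The Perron vector and the spectral radius\<close>

text \<open>Maximises the quadratic form over nonnegative unit vectors. As \<open>a\<close> is
  nonnegative, taking absolute values never lowers the form, so the maximum bounds the Rayleigh
  quotient of all vectors, and perturbing one coordinate yields the eigenvector equation.\<close>

lemma symmetric_nonneg_top_eigenvector:
  fixes a :: "'a \<Rightarrow> 'a \<Rightarrow> real"
  assumes fin: "finite V" and ne: "V \<noteq> {}"
    and sym: "\<And>i j. a i j = a j i" and nonneg: "\<And>i j. a i j \<ge> 0"
  obtains x l where "\<And>i. i \<in> V \<Longrightarrow> x i \<ge> 0" "\<exists>i\<in>V. x i > 0"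
    "\<And>i. i \<in> V \<Longrightarrow> (\<Sum>j\<in>V. a i j * x j) = l * x i"
proof -
  define Q where "Q y = (\<Sum>i\<in>V. \<Sum>j\<in>V. a i j * y i * y j)" for y :: "'a \<Rightarrow> real"
  define N where "N y = (\<Sum>i\<in>V. (y i)\<^sup>2)" for y :: "'a \<Rightarrow> real"
  \<comment> \<open>Vectors are functions on the whole type, pinned to 0 outside \<open>V\<close>,
    so compactness is that of a product of compact sets.\<close>
  define P where "P = PiE UNIV (\<lambda>i. if i \<in> V then {0..1::real} else {0})"
  define K where "K = P \<inter> {y. N y = 1}"
  have contN: "continuous_on UNIV N" unfolding N_def
    by (intro continuous_intros continuous_on_product_coordinates)
  have contQ: "continuous_on UNIV Q" unfolding Q_def
    by (intro continuous_intros continuous_on_product_coordinates)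
  have "compactin (product_topology (\<lambda>i::'a. euclidean :: real topology) UNIV) P"
    unfolding P_def compactin_PiE by auto
  then have "compact P" by (simp add: euclidean_product_topology)
  moreover have "closed {y. N y = 1}"
    using contN by (intro closed_Collect_eq) (auto intro: continuous_intros)
  ultimately have comp: "compact K" unfolding K_def by (rule compact_Int_closed)
  have scale: "\<exists>z\<in>K. Q z \<ge> Q y / N y" if y: "N y > 0" for y
  proof -
    define z where "z i = (if i \<in> V then \<bar>y i\<bar> / sqrt (N y) else 0)" for i
    have Nz: "N z = 1"
    proof -
      have "N z = (\<Sum>i\<in>V. (y i)\<^sup>2 / N y)"
        unfolding N_def[of z] z_def using y by (intro sum.cong) (auto simp: power_divide)
      also have "\<dots> = 1" using y by (simp add: sum_divide_distrib[symmetric] N_def[symmetric])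
      finally show ?thesis .
    qed
    have "z i \<le> 1" if i: "i \<in> V" for i
    proof -
      have "(z i)\<^sup>2 \<le> N z" unfolding N_def using fin i by (intro member_le_sum) auto
      then show ?thesis using Nz by (simp add: abs_square_le_1 abs_le_iff)
    qed
    moreover have "z i \<ge> 0" for i using y by (simp add: z_def)
    moreover have "z i = 0" if "i \<notin> V" for i using that by (simp add: z_def)
    ultimately have "z \<in> K" using Nz by (auto simp: K_def P_def PiE_def)
    moreover have "Q y / N y \<le> Q z"
      unfolding Q_def sum_divide_distrib
    proof (intro sum_mono)
      fix i j assume "i \<in> V" "j \<in> V"
      then have "a i j * z i * z j = a i j * (\<bar>y i\<bar> * \<bar>y j\<bar>) / N y"
        using y by (simp add: z_def)
      moreover have "a i j * (y i * y j) \<le> a i j * (\<bar>y i\<bar> * \<bar>y j\<bar>)"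
        using nonneg[of i j] by (intro mult_left_mono) (simp_all flip: abs_mult)
      ultimately show "a i j * y i * y j / N y \<le> a i j * z i * z j"
        using y by (simp add: divide_right_mono mult.assoc)
    qed
    ultimately show ?thesis by blast
  qed
  have "N (\<lambda>_. 1) > 0" using fin ne by (simp add: N_def card_gt_0_iff)
  then have "K \<noteq> {}" using scale by blast
  then obtain x where x: "x \<in> K" "\<And>y. y \<in> K \<Longrightarrow> Q y \<le> Q x"
    using continuous_attains_sup[OF comp] contQ continuous_on_subset by (metis subset_UNIV)
  define l where "l = Q x"
  have Nx: "N x = 1" using x(1) by (simp add: K_def)
  have x0: "x i \<ge> 0" if "i \<in> V" for i
  proof -
    have "x i \<in> (if i \<in> V then {0..1} else {0})" using x(1) by (auto simp: K_def P_def PiE_def Pi_def)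
    then show ?thesis using that by simp
  qed
  have max: "Q y \<le> l * N y" for y
  proof (cases "N y > 0")
    case True
    then obtain z where "z \<in> K" "Q z \<ge> Q y / N y" using scale by blast
    then have "Q y / N y \<le> l" using x(2) unfolding l_def by force
    then show ?thesis using True by (simp add: divide_le_eq)
  next
    case False
    moreover have "N y \<ge> 0" unfolding N_def by (intro sum_nonneg) auto
    ultimately have N0: "N y = 0" by simp
    then have "\<forall>i\<in>V. y i = 0" unfolding N_def using fin by (simp add: sum_nonneg_eq_0_iff)
    then have "Q y = 0" by (simp add: Q_def)
    then show ?thesis using N0 by simp
  qed
  have eigen: "(\<Sum>j\<in>V. a i j * x j) = l * x i" if i: "i \<in> V" for i
  proof -
    define b where "b = (\<Sum>j\<in>V. a i j * x j)"
    \<comment> \<open>Any positive upper bound for \<open>l - a i i\<close> would do. The inequality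
      is later tested at \<open>s = d / c\<close>, which maximises the left side minus the
      right.\<close>
    define c where "c = \<bar>l\<bar> + a i i + 1"
    have pert: "2 * s * (b - l * x i) \<le> c * s\<^sup>2" for s :: real
    proof -
      define \<delta> where "\<delta> j = (if j = i then s else 0)" for j
      define y where "y j = x j + \<delta> j" for j
      have d: "(\<Sum>j\<in>V. h j * \<delta> j) = h i * s" for h
        unfolding \<delta>_def using fin i by (simp add: if_distrib sum.delta cong: if_cong)
      have "N y = N x + 2 * (\<Sum>j\<in>V. x j * \<delta> j) + (\<Sum>j\<in>V. \<delta> j * \<delta> j)"
        unfolding N_def y_def by (simp add: sum.distrib[symmetric] sum_distrib_left power2_eq_square algebra_simps)
      also have "\<dots> = 1 + 2 * x i * s + s\<^sup>2"
        unfolding d Nx by (simp add: \<delta>_def power2_eq_square)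
      finally have Ny: "N y = 1 + 2 * x i * s + s\<^sup>2" .
      have "Q y = (\<Sum>i\<in>V. \<Sum>j\<in>V. a i j * x i * x j) + (\<Sum>i\<in>V. \<Sum>j\<in>V. a i j * x i * \<delta> j)
          + (\<Sum>i\<in>V. \<Sum>j\<in>V. a i j * x j * \<delta> i) + (\<Sum>i\<in>V. \<Sum>j\<in>V. a i j * \<delta> i * \<delta> j)"
        unfolding Q_def y_def by (simp add: sum.distrib[symmetric] algebra_simps)
      also have "(\<Sum>i\<in>V. \<Sum>j\<in>V. a i j * x i * \<delta> j) = b * s"
        unfolding d b_def by (simp add: sum_distrib_right sym[of _ i])
      also have "(\<Sum>i\<in>V. \<Sum>j\<in>V. a i j * x j * \<delta> i) = b * s"
        unfolding sum_distrib_right[symmetric] d b_def ..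
      also have "(\<Sum>i\<in>V. \<Sum>j\<in>V. a i j * \<delta> i * \<delta> j) = a i i * s\<^sup>2"
        unfolding d using d[of "\<lambda>j. a j i * s"]
        by (simp add: power2_eq_square mult_ac)
      also have "(\<Sum>i\<in>V. \<Sum>j\<in>V. a i j * x i * x j) = l" unfolding l_def Q_def ..
      finally have "l + b * s + b * s + a i i * s\<^sup>2 \<le> l * (1 + 2 * x i * s + s\<^sup>2)"
        using max[of y] Ny by simp
      then have "2 * s * (b - l * x i) \<le> (l - a i i) * s\<^sup>2" by (simp add: algebra_simps)
      also have "\<dots> \<le> c * s\<^sup>2" unfolding c_def using nonneg[of i i] by (intro mult_right_mono) auto
      finally show ?thesis .
    qed
    have c: "c > 0" unfolding c_def using nonneg[of i i] by simp
    define d where "d = b - l * x i"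
    have "2 * (d / c) * d \<le> c * (d / c)\<^sup>2" using pert[of "d / c"] unfolding d_def .
    then have "2 * d\<^sup>2 \<le> d\<^sup>2" using c by (simp add: power2_eq_square field_simps)
    then have "d = 0" by simp
    then show ?thesis by (simp add: d_def b_def)
  qed
  have "\<exists>i\<in>V. x i > 0"
  proof (rule ccontr)
    assume "\<not> ?thesis"
    then have "\<forall>i\<in>V. x i = 0" using x0 by force
    then show False using Nx by (simp add: N_def)
  qed
  then show ?thesis using that[of x l] x0 eigen by blast
qed

section \<open>The adjacency matrix and its Perron vector\<close>

lemma adj_sym: "adj E i j = adj E j i"
  by (auto simp: adj_def conj_commute)

lemma adj_nonneg:
  assumes "hypergraph V E" shows "adj E i j \<ge> 0"
  unfolding adj_def using assms by (auto simp: hypergraph_def intro!: sum_nonneg)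

lemma adj_pos:
  assumes "hypergraph V E" "e \<in> E" "i \<in> e" "j \<in> e" "i \<noteq> j"
  shows "adj E i j > 0"
proof -
  have fin: "finite E" using assms(1) unfolding hypergraph_def
    by (meson Pow_iff finite_Pow_iff rev_finite_subset subsetI)
  have pos: "1 / (real (card e') - 1) > 0" if "e' \<in> E" for e'
    using assms(1) that by (auto simp: hypergraph_def)
  have "(\<Sum>e\<in>{e\<in>E. i \<in> e \<and> j \<in> e}. 1 / (real (card e) - 1)) > 0"
    using fin assms pos by (intro sum_pos) auto
  then show ?thesis using assms(5) by (simp add: adj_def)
qed

text \<open>Makes the \<open>Max\<close> in \<open>spectral_radius\<close> meaningful: after
  numbering the vertices, eigenvalues are roots of a characteristic polynomial.\<close>

lemma finite_adj_eigenvalues: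
  assumes "finite V"
  shows "finite {mu. adj_eigenvalue V E mu}"
proof -
  define n where "n = card V"
  obtain h where h: "bij_betw h {0..<n} V"
    using ex_bij_betw_nat_finite[OF assms] unfolding n_def by blast
  define A where "A = mat n n (\<lambda>(i, j). complex_of_real (adj E (h i) (h j)))"
  have A: "A \<in> carrier_mat n n" by (simp add: A_def)
  have "poly (char_poly A) mu = 0" if mu: "adj_eigenvalue V E mu" for mu
  proof -
    obtain x i0 where x: "i0 \<in> V" "x i0 \<noteq> 0"
      "\<And>i. i \<in> V \<Longrightarrow> (\<Sum>j\<in>V. complex_of_real (adj E i j) * x j) = mu * x i"
      using mu unfolding adj_eigenvalue_def by blast
    define y where "y = vec n (\<lambda>i. x (h i))"
    obtain j0 where j0: "j0 < n" "h j0 = i0" using x(1) h by (auto simp: bij_betw_def)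
    have "y \<noteq> 0\<^sub>v n"
    proof
      assume "y = 0\<^sub>v n"
      then have "y $ j0 = 0" using j0 by simp
      then show False using j0 x by (simp add: y_def)
    qed
    moreover have "A *\<^sub>v y = mu \<cdot>\<^sub>v y"
    proof (rule eq_vecI)
      fix i assume i: "i < dim_vec (mu \<cdot>\<^sub>v y)"
      then have i: "i < n" by (simp add: y_def)
      then have hi: "h i \<in> V" using h by (auto simp: bij_betw_def)
      have "(A *\<^sub>v y) $ i = (\<Sum>j\<in>{0..<n}. complex_of_real (adj E (h i) (h j)) * x (h j))"
        using i by (simp add: A_def y_def scalar_prod_def)
      also have "\<dots> = (\<Sum>j\<in>V. complex_of_real (adj E (h i) j) * x j)"
        by (rule sum.reindex_bij_betw[OF h])
      also have "\<dots> = mu * x (h i)" by (rule x(3)[OF hi])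
      finally show "(A *\<^sub>v y) $ i = (mu \<cdot>\<^sub>v y) $ i" using i by (simp add: y_def)
    qed (simp add: A_def y_def)
    ultimately have "eigenvalue A mu"
      unfolding eigenvalue_def eigenvector_def using A by (auto simp: y_def intro!: exI[of _ y])
    then show ?thesis using eigenvalue_root_char_poly[OF A] by blast
  qed
  moreover have "char_poly A \<noteq> 0" using degree_monic_char_poly[OF A] by force
  then have "finite {mu. poly (char_poly A) mu = 0}" by (rule poly_roots_finite)
  ultimately show ?thesis by (metis (mono_tags, lifting) Collect_mono finite_subset)
qed

text \<open>A zero entry sharing an edge with a positive one would violate its own equation, so
  positivity spreads by connectedness. Pairing the entrywise bound on
  \<open>cmod mu * cmod (y i)\<close> with the positive \<open>x\<close> shows that no eigenvalue
  exceeds \<open>l\<close> in modulus.\<close>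

lemma perron_vector:
  assumes hg: "hypergraph V E" and con: "connected_hg V E"
  obtains x where "\<And>i. i \<in> V \<Longrightarrow> x i > 0"
    "\<And>i. i \<in> V \<Longrightarrow> (\<Sum>j\<in>V. adj E i j * x j) = spectral_radius V E * x i"
proof -
  have fin: "finite V" and ne: "V \<noteq> {}" and sub: "\<And>e. e \<in> E \<Longrightarrow> e \<subseteq> V"
    using hg by (auto simp: hypergraph_def)
  obtain x l where x0: "\<And>i. i \<in> V \<Longrightarrow> x i \<ge> 0" and xp: "\<exists>i\<in>V. x i > 0"
    and ev: "\<And>i. i \<in> V \<Longrightarrow> (\<Sum>j\<in>V. adj E i j * x j) = l * x i"
    using symmetric_nonneg_top_eigenvector[OF fin ne, of "adj E", OF adj_sym adj_nonneg[OF hg]] by blast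
  have l0: "l \<ge> 0"
  proof -
    obtain i where i: "i \<in> V" "x i > 0" using xp by blast
    have "(\<Sum>j\<in>V. adj E i j * x j) \<ge> 0"
      using adj_nonneg[OF hg] x0 by (intro sum_nonneg) auto
    then show ?thesis using ev[OF i(1)] i(2) by (simp add: zero_le_mult_iff)
  qed
  have step: "x j > 0" if "x i > 0" "e \<in> E" "i \<in> e" "j \<in> e" for i j e
  proof (rule ccontr)
    assume "\<not> x j > 0"
    have ij: "i \<in> V" "j \<in> V" using sub that by blast+
    then have xj: "x j = 0" using x0[of j] \<open>\<not> x j > 0\<close> by simp
    then have "i \<noteq> j" using that by auto
    then have "adj E j i * x i > 0" using adj_pos[OF hg that(2,4,3)] that(1) by simp
    moreover have "adj E j i * x i \<le> (\<Sum>m\<in>V. adj E j m * x m)"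
      using ij fin adj_nonneg[OF hg] x0 by (intro member_le_sum) auto
    ultimately show False using ev[OF ij(2)] xj by simp
  qed
  obtain r where r: "r \<in> V" "x r > 0" using xp by blast
  have pos: "x i > 0" if "i \<in> V" for i
  proof -
    have "(r, i) \<in> (joined E)\<^sup>*" using con r that by (auto simp: connected_hg_def)
    then show ?thesis
      by (induction rule: rtrancl_induct) (use r step in auto)
  qed
  have le: "cmod mu \<le> l" if mu: "adj_eigenvalue V E mu" for mu
  proof -
    obtain y i0 where y: "i0 \<in> V" "y i0 \<noteq> 0"
      "\<And>i. i \<in> V \<Longrightarrow> (\<Sum>j\<in>V. complex_of_real (adj E i j) * y j) = mu * y i"
      using mu unfolding adj_eigenvalue_def by blast
    define p where "p = (\<Sum>i\<in>V. x i * cmod (y i))"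
    have "0 < x i0 * cmod (y i0)" using pos y by simp
    also have "\<dots> \<le> p" unfolding p_def using fin y(1) x0 by (intro member_le_sum) auto
    finally have p: "p > 0" .
    have "cmod mu * p = (\<Sum>i\<in>V. x i * cmod (mu * y i))"
      unfolding p_def by (simp add: sum_distrib_left norm_mult mult_ac)
    also have "\<dots> \<le> (\<Sum>i\<in>V. x i * (\<Sum>j\<in>V. adj E i j * cmod (y j)))"
    proof (intro sum_mono mult_left_mono)
      fix i assume i: "i \<in> V"
      have "cmod (mu * y i) \<le> (\<Sum>j\<in>V. cmod (complex_of_real (adj E i j) * y j))"
        unfolding y(3)[OF i, symmetric] by (rule norm_sum)
      then show "cmod (mu * y i) \<le> (\<Sum>j\<in>V. adj E i j * cmod (y j))"
        using adj_nonneg[OF hg] by (simp add: norm_mult)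
    qed (use x0 in auto)
    also have "\<dots> = (\<Sum>j\<in>V. (\<Sum>i\<in>V. adj E j i * x i) * cmod (y j))"
      unfolding sum_distrib_left sum_distrib_right
      by (subst sum.swap) (simp add: adj_sym mult_ac)
    also have "\<dots> = l * p" unfolding p_def sum_distrib_left
      by (intro sum.cong) (auto simp: ev mult.assoc)
    finally show ?thesis using p by simp
  qed
  have "adj_eigenvalue V E (complex_of_real l)"
    unfolding adj_eigenvalue_def
  proof (intro exI[of _ "\<lambda>i. complex_of_real (x i)"] conjI ballI)
    show "\<exists>i\<in>V. complex_of_real (x i) \<noteq> 0" using xp by force
    show "(\<Sum>j\<in>V. complex_of_real (adj E i j) * complex_of_real (x j))
        = complex_of_real l * complex_of_real (x i)" if "i \<in> V" for i
      using arg_cong[OF ev[OF that], of complex_of_real] by simp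
  qed
  then have "l \<in> cmod ` {mu. adj_eigenvalue V E mu}" using l0 by force
  then have "spectral_radius V E = l" unfolding spectral_radius_def
    using finite_adj_eigenvalues[OF fin] le by (intro Max_eqI) auto
  then show ?thesis using that[of x] pos ev by blast
qed

lemma isomorphic_spectral_radius:
  assumes "hypergraph V E" "hg_isomorphic V E V' E'"
  shows "spectral_radius V E = spectral_radius V' E'"
proof -
  obtain f where f: "bij_betw f V V'" and E': "E' = (\<lambda>e. f ` e) ` E"
    using assms(2) unfolding hg_isomorphic_def by blast
  have sub: "\<And>e. e \<in> E \<Longrightarrow> e \<subseteq> V" using assms(1) by (auto simp: hypergraph_def)
  have inj: "inj_on f V" using f by (rule bij_betw_imp_inj_on)
  have adj: "adj E' (f i) (f j) = adj E i j" if ij: "i \<in> V" "j \<in> V" for i j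
  proof -
    have mem: "f i \<in> f ` e \<longleftrightarrow> i \<in> e" if "e \<in> E" "i \<in> V" for e i
      using inj sub[OF that(1)] that(2) by (simp add: inj_on_image_mem_iff)
    have inj_im: "inj_on ((`) f) {e \<in> E. i \<in> e \<and> j \<in> e}"
      using inj_on_image_Pow[OF inj] by (rule inj_on_subset) (use sub in auto)
    have "{e \<in> E'. f i \<in> e \<and> f j \<in> e} = (`) f ` {e \<in> E. i \<in> e \<and> j \<in> e}"
      unfolding E' using mem ij by auto
    then have "(\<Sum>e\<in>{e \<in> E'. f i \<in> e \<and> f j \<in> e}. 1 / (real (card e) - 1))
        = (\<Sum>e\<in>{e \<in> E. i \<in> e \<and> j \<in> e}. 1 / (real (card (f ` e)) - 1))"
      by (simp add: sum.reindex[OF inj_im])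
    also have "\<dots> = (\<Sum>e\<in>{e \<in> E. i \<in> e \<and> j \<in> e}. 1 / (real (card e) - 1))"
      using inj sub by (intro sum.cong) (auto simp: card_image inj_on_subset)
    moreover have "f i = f j \<longleftrightarrow> i = j" using inj ij by (auto simp: inj_on_def)
    ultimately show ?thesis by (simp add: adj_def)
  qed
  have sums: "(\<Sum>j\<in>V'. complex_of_real (adj E' (f i) j) * x j)
      = (\<Sum>j\<in>V. complex_of_real (adj E i j) * x (f j))" if "i \<in> V" for i x
    unfolding sum.reindex_bij_betw[OF f, symmetric]
    using that by (intro sum.cong) (auto simp: adj)
  have V': "V' = f ` V" using f by (simp add: bij_betw_def)
  have "adj_eigenvalue V E mu \<longleftrightarrow> adj_eigenvalue V' E' mu" for mu
  proof
    assume "adj_eigenvalue V' E' mu"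
    then obtain x where "\<exists>i\<in>V'. x i \<noteq> 0"
      "\<forall>i\<in>V'. (\<Sum>j\<in>V'. complex_of_real (adj E' i j) * x j) = mu * x i"
      unfolding adj_eigenvalue_def by blast
    then show "adj_eigenvalue V E mu"
      unfolding adj_eigenvalue_def by (intro exI[of _ "\<lambda>i. x (f i)"]) (auto simp: V' sums[unfolded V'])
  next
    assume "adj_eigenvalue V E mu"
    then obtain x where x: "\<exists>i\<in>V. x i \<noteq> 0"
      "\<forall>i\<in>V. (\<Sum>j\<in>V. complex_of_real (adj E i j) * x j) = mu * x i"
      unfolding adj_eigenvalue_def by blast
    define y where "y = (\<lambda>i. x (inv_into V f i))"
    have y: "y (f i) = x i" if "i \<in> V" for i using that inj by (simp add: y_def)
    have "(\<Sum>j\<in>V'. complex_of_real (adj E' (f i) j) * y j) = mu * y (f i)" if "i \<in> V" for i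
      unfolding sums[OF that] using x(2) that y by simp
    then show "adj_eigenvalue V' E' mu"
      unfolding adj_eigenvalue_def using x(1) y by (intro exI[of _ y]) (auto simp: V')
  qed
  then show ?thesis by (simp add: spectral_radius_def)
qed

section \<open>Comparison with the hyperpath\<close>

lemma adj_sum_flow:
  assumes "hypergraph V E" "k_uniform k E" "i \<in> V"
  shows "(\<Sum>j\<in>V. adj E i j * x j) = flow E x i / (real k - 1)"
proof -
  have fV: "finite V" and sub: "\<And>e. e \<in> E \<Longrightarrow> e \<subseteq> V" using assms(1) by (auto simp: hypergraph_def)
  have fE: "finite E" using fV sub by (meson Pow_iff finite_Pow_iff rev_finite_subset subsetI)
  have "(\<Sum>j\<in>V. adj E i j * x j)
      = (\<Sum>j\<in>V. \<Sum>e\<in>{e\<in>E. i \<in> e}. if j \<in> e - {i} then x j / (real k - 1) else 0)"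
  proof (rule sum.cong[OF refl])
    fix j
    have "(\<Sum>e\<in>{e\<in>E. i \<in> e}. if j \<in> e - {i} then x j / (real k - 1) else 0)
        = (if i = j then 0 else (\<Sum>e\<in>{e\<in>E. i \<in> e}. if j \<in> e then x j / (real k - 1) else 0))"
      by auto
    also have "(\<Sum>e\<in>{e\<in>E. i \<in> e}. if j \<in> e then x j / (real k - 1) else 0)
        = (\<Sum>e\<in>{e\<in>E. i \<in> e \<and> j \<in> e}. x j / (real k - 1))"
      using fE by (intro sum.mono_neutral_cong_right) auto
    also have "\<dots> = (\<Sum>e\<in>{e\<in>E. i \<in> e \<and> j \<in> e}. 1 / (real (card e) - 1)) * x j"
      unfolding sum_distrib_right using assms(2) by (intro sum.cong) (auto simp: k_uniform_def)
    finally show "adj E i j * x j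
        = (\<Sum>e\<in>{e\<in>E. i \<in> e}. if j \<in> e - {i} then x j / (real k - 1) else 0)"
      by (simp add: adj_def)
  qed
  also have "\<dots> = (\<Sum>e\<in>{e\<in>E. i \<in> e}. \<Sum>j\<in>V. if j \<in> e - {i} then x j / (real k - 1) else 0)"
    by (rule sum.swap)
  also have "\<dots> = (\<Sum>e\<in>{e\<in>E. i \<in> e}. (sum x e - x i) / (real k - 1))"
  proof (rule sum.cong[OF refl])
    fix e assume e: "e \<in> {e\<in>E. i \<in> e}"
    then have fe: "finite e" "e \<subseteq> V" using sub fV finite_subset by blast+
    have "(\<Sum>j\<in>V. if j \<in> e - {i} then x j / (real k - 1) else 0) = (\<Sum>j\<in>e - {i}. x j / (real k - 1))"
      using fe fV by (intro sum.mono_neutral_cong_right) auto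
    also have "\<dots> = (sum x e - x i) / (real k - 1)"
      using e fe by (simp add: sum_divide_distrib[symmetric] sum_diff1)
    finally show "(\<Sum>j\<in>V. if j \<in> e - {i} then x j / (real k - 1) else 0)
        = (sum x e - x i) / (real k - 1)" .
  qed
  finally show ?thesis by (simp add: flow_def sum_divide_distrib)
qed

text \<open>Pair the inequality with the positive Perron vector and use symmetry of the matrix;
  strictness at one vertex survives because all weights are positive.\<close>

lemma spectral_radius_le_supersolution:
  assumes hg: "hypergraph V E" and con: "connected_hg V E"
    and pos: "\<And>i. i \<in> V \<Longrightarrow> z i > 0"
    and le: "\<And>i. i \<in> V \<Longrightarrow> (\<Sum>j\<in>V. adj E i j * z j) \<le> l * z i"
  shows "spectral_radius V E \<le> l"
    and "i \<in> V \<Longrightarrow> (\<Sum>j\<in>V. adj E i j * z j) < l * z i \<Longrightarrow> spectral_radius V E < l"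
proof -
  have fin: "finite V" and ne: "V \<noteq> {}" using hg by (auto simp: hypergraph_def)
  obtain y where y: "\<And>i. i \<in> V \<Longrightarrow> y i > 0"
    "\<And>i. i \<in> V \<Longrightarrow> (\<Sum>j\<in>V. adj E i j * y j) = spectral_radius V E * y i"
    using perron_vector[OF hg con] by blast
  define p where "p = (\<Sum>i\<in>V. y i * z i)"
  have p: "p > 0" unfolding p_def using fin ne y pos by (intro sum_pos) auto
  have "(\<Sum>i\<in>V. y i * (\<Sum>j\<in>V. adj E i j * z j)) = (\<Sum>j\<in>V. (\<Sum>i\<in>V. adj E j i * y i) * z j)"
    unfolding sum_distrib_left sum_distrib_right
    by (subst sum.swap) (simp add: adj_sym mult_ac)
  also have "\<dots> = spectral_radius V E * p"
    unfolding p_def sum_distrib_left by (intro sum.cong) (auto simp: y mult.assoc)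
  finally have eq: "spectral_radius V E * p = (\<Sum>i\<in>V. y i * (\<Sum>j\<in>V. adj E i j * z j))" by simp
  have lp: "(\<Sum>i\<in>V. y i * (l * z i)) = l * p" unfolding p_def by (simp add: sum_distrib_left mult_ac)
  have "spectral_radius V E * p \<le> l * p"
    unfolding eq lp[symmetric] using y(1) le by (intro sum_mono mult_left_mono) (auto simp: less_imp_le)
  then show "spectral_radius V E \<le> l" using p by simp
  assume i: "i \<in> V" "(\<Sum>j\<in>V. adj E i j * z j) < l * z i"
  have "spectral_radius V E * p < l * p"
    unfolding eq lp[symmetric]
  proof (rule sum_strict_mono_ex1[OF fin])
    show "\<forall>i\<in>V. y i * (\<Sum>j\<in>V. adj E i j * z j) \<le> y i * (l * z i)"
      using y(1) le by (auto simp: less_imp_le intro!: mult_left_mono)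
    show "\<exists>i\<in>V. y i * (\<Sum>j\<in>V. adj E i j * z j) < y i * (l * z i)"
      using i y(1) by (intro bexI[of _ i]) auto
  qed
  then show "spectral_radius V E < l" using p by simp
qed

text \<open>Supplies \<open>\<mu> \<ge> \<kappa> + 2\<close>. At each vertex of one fixed edge only
  that edge is kept, and the resulting inequalities are added.\<close>

lemma spectral_radius_ge_1:
  assumes hg: "hypergraph V E" and con: "connected_hg V E" and un: "k_uniform k E"
    and "E \<noteq> {}" "k \<ge> 2"
  shows "spectral_radius V E \<ge> 1"
proof -
  obtain x where x: "\<And>i. i \<in> V \<Longrightarrow> x i > 0"
    "\<And>i. i \<in> V \<Longrightarrow> (\<Sum>j\<in>V. adj E i j * x j) = spectral_radius V E * x i"
    using perron_vector[OF hg con] by blast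
  obtain e where e: "e \<in> E" using assms(4) by blast
  have sub: "\<And>e. e \<in> E \<Longrightarrow> finite e \<and> e \<subseteq> V" "finite E"
    using hg unfolding hypergraph_def by (meson finite_subset Pow_iff finite_Pow_iff subsetI)+
  define l where "l = (real k - 1) * spectral_radius V E"
  have "sum x e - x v \<le> l * x v" if v: "v \<in> e" for v
  proof -
    have vV: "v \<in> V" using v e sub by blast
    have "flow E x v = l * x v"
      using adj_sum_flow[OF hg un vV, of x] x(2)[OF vV] assms(5) by (simp add: l_def field_simps)
    moreover have "sum x e - x v \<le> flow E x v"
      unfolding flow_def
    proof (rule member_le_sum)
      fix e' assume "e' \<in> {e \<in> E. v \<in> e} - {e}"
      then have "x v \<le> sum x e'" using sub x(1) by (intro member_le_sum) (auto intro: less_imp_le)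
      then show "0 \<le> sum x e' - x v" by simp
    qed (use e v sub in auto)
    ultimately show ?thesis by simp
  qed
  then have "(\<Sum>v\<in>e. sum x e - x v) \<le> (\<Sum>v\<in>e. l * x v)" by (intro sum_mono)
  then have "real k * sum x e - sum x e \<le> l * sum x e"
    using un e by (simp add: sum_subtractf sum_distrib_left k_uniform_def)
  moreover have "sum x e > 0"
  proof (rule sum_pos)
    show "e \<noteq> {}" using un e assms(5) by (auto simp: k_uniform_def)
  qed (use sub e x in auto)
  ultimately have "real k - 1 \<le> l"
    by (intro mult_right_le_imp_le[of "real k - 1" "sum x e" l]) (simp_all add: left_diff_distrib)
  then show ?thesis using assms(5) by (simp add: l_def)
qed

text \<open>The leaves of a pendant edge all hold \<open>S / \<mu>\<close>, which fixes
  \<open>S / x w\<close> and hence the contribution of the remaining branch at \<open>w\<close> as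
  \<open>\<mu> - \<mu> / (\<mu> - \<kappa> - 1)\<close>. That \<open>f M\<close> is at most this
  value is, cleared of denominators, \<open>t (Suc M) - u (Suc M) \<ge> 0\<close>.\<close>

lemma supertree_vs_rooted_path:
  assumes k: "k \<ge> 3" and st: "supertree V E" and un: "k_uniform k E" and ne: "E \<noteq> {}"
    and rp: "rooted_path k r' VP EP" and hgP: "hypergraph VP EP" and card: "card E = card EP"
  shows "spectral_radius VP EP \<le> spectral_radius V E"
    and "spectral_radius VP EP = spectral_radius V E \<Longrightarrow> \<exists>r. rooted_path k r V E"
proof -
  have k2: "k \<ge> 2" using k by simp
  have hg: "hypergraph V E" and con: "connected_hg V E" using st by (auto simp: supertree_def)
  have unP: "k_uniform k EP" using rooted_path_basic(4)[OF rp k2] by (auto simp: k_uniform_def)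
  have conP: "connected_hg VP EP" using rooted_path_connected[OF rp] by (intro connected_hg_if_root)
  define \<rho> where "\<rho> = spectral_radius V E"
  define \<kappa> where "\<kappa> = real k - 2"
  define \<mu> where "\<mu> = (real k - 1) * \<rho> + 1"
  have "(real k - 1) * 1 \<le> (real k - 1) * \<rho>"
    using spectral_radius_ge_1[OF hg con un ne k2] k unfolding \<rho>_def by (intro mult_left_mono) auto
  then have "\<kappa> \<ge> 1" "\<mu> \<ge> \<kappa> + 2" using k by (simp_all add: \<kappa>_def \<mu>_def algebra_simps)
  then interpret path_recurrence \<mu> \<kappa> by unfold_locales
  have kk: "real k = \<kappa> + 2" by (simp add: \<kappa>_def)
  obtain x where x: "\<And>i. i \<in> V \<Longrightarrow> x i > 0"
    "\<And>i. i \<in> V \<Longrightarrow> (\<Sum>j\<in>V. adj E i j * x j) = \<rho> * x i"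
    using perron_vector[OF hg con] unfolding \<rho>_def by blast
  have flow: "flow E x v = (\<mu> - 1) * x v" if "v \<in> V" for v
    using adj_sum_flow[OF hg un that, of x] x(2)[OF that] k by (simp add: \<mu>_def field_simps)
  obtain e w Vf Ef where s: "w \<in> e" "card e = k"
    "\<forall>v\<in>e. rooted_supertree k v (Vf v) (Ef v)" "disjoint_family_on Vf e"
    "V = (\<Union>w\<in>e. Vf w)" "E = insert e (\<Union>w\<in>e. Ef w)"
    "\<forall>v\<in>e - {w}. Ef v = {} \<and> Vf v = {v}"
    by (rule supertree_pendant_split[OF st un ne k2], rule that, assumption+)
  note gf = graft_facts[OF k2 s(2-4)]
  note fl = flow_graft[OF k2 s(2-4), folded s(6)]
  note basic = rooted_supertree_basic[OF s(3)[rule_format] k2]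
  define S where "S = sum x e"
  define M where "M = card (Ef w)"
  have cardE: "card E = Suc M"
  proof -
    have "(\<Sum>v\<in>e. card (Ef v)) = M + (\<Sum>v\<in>e - {w}. card (Ef v))"
      unfolding M_def using gf(1) s(1) by (simp add: sum.remove)
    also have "(\<Sum>v\<in>e - {w}. card (Ef v)) = 0" using s(7) by simp
    finally show ?thesis using gf(5) s(6) by simp
  qed
  have eV: "v \<in> Vf v" "v \<in> V" if "v \<in> e" for v using basic(3)[OF that] that s(5) by blast+
  have leaf: "x v = S / \<mu>" if v: "v \<in> e - {w}" for v
  proof -
    have "flow E x v = S - x v + flow (Ef v) x v" using fl[of v v x] eV v by (simp add: S_def)
    moreover have "flow (Ef v) x v = 0" using s(7) v by (simp add: flow_def)
    ultimately have "\<mu> * x v = S" using flow[of v] eV v by (simp add: algebra_simps)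
    then show ?thesis using mu_pos by (simp add: field_simps)
  qed
  have xw: "x w > 0" using x(1) eV s(1) by blast
  have Ssplit: "S = x w + (\<kappa> + 1) * (S / \<mu>)"
  proof -
    have "S = x w + sum x (e - {w})" unfolding S_def using gf(1) s(1) by (simp add: sum.remove)
    also have "sum x (e - {w}) = (\<Sum>v\<in>e - {w}. S / \<mu>)" by (intro sum.cong refl leaf)
    also have "\<dots> = (\<kappa> + 1) * (S / \<mu>)"
    proof -
      have "real (card (e - {w})) = \<kappa> + 1" using gf(1) s(1,2) k by (simp add: kk[symmetric] \<kappa>_def of_nat_diff)
      then show ?thesis by simp
    qed
    finally show ?thesis .
  qed
  then have xwS: "\<mu> * x w = (\<mu> - \<kappa> - 1) * S" using mu_pos by (simp add: field_simps)
  have m1: "\<mu> - \<kappa> - 1 > 0" using mu by simp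
  have "S > 0" using xwS xw mu_pos m1 by (metis mult_pos_pos zero_less_mult_pos)
  then have Sw: "S > x w" using Ssplit mu_pos kappa by (smt (verit) divide_pos_pos mult_pos_pos)
  have flw: "flow (Ef w) x w = \<mu> * x w - S"
    using fl[of w w x] eV[OF s(1)] s(1) flow[of w] by (simp add: S_def algebra_simps)
  have "good M \<and> f M \<le> flow (Ef w) x w / x w \<and>
    (f M = flow (Ef w) x w / x w \<longrightarrow> rooted_path k w (Vf w) (Ef w))"
    unfolding M_def
  proof (rule rooted_supertree_bound[OF kk])
    show "rooted_supertree k w (Vf w) (Ef w)" using s by blast
    show "\<forall>v\<in>Vf w. x v > 0" using x(1) s by blast
    show "\<forall>v\<in>Vf w - {w}. flow (Ef w) x v = (\<mu> - 1) * x v"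
    proof
      fix v assume v: "v \<in> Vf w - {w}"
      then have "v \<in> V" using s(1,5) by blast
      then show "flow (Ef w) x v = (\<mu> - 1) * x v" using flow[of v] fl[of w v x] s(1) v by simp
    qed
    show "flow (Ef w) x w < (\<mu> - 1) * x w" using flw Sw by (simp add: algebra_simps)
  qed
  moreover have "flow (Ef w) x w / x w = \<mu> - \<mu> / (\<mu> - \<kappa> - 1)"
  proof -
    have "S / x w = \<mu> / (\<mu> - \<kappa> - 1)" using xwS xw m1 by (simp add: frac_eq_eq mult.commute)
    then show ?thesis using flw xw by (simp add: diff_divide_distrib)
  qed
  ultimately have bound: "good M" "f M \<le> \<mu> - \<mu> / (\<mu> - \<kappa> - 1)"
    "f M = \<mu> - \<mu> / (\<mu> - \<kappa> - 1) \<Longrightarrow> rooted_path k w (Vf w) (Ef w)" by auto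
  have uM: "u M > 0" using bound(1) by (simp add: good_def)
  have defect: "t (Suc M) - u (Suc M) = (\<mu> - \<kappa> - 1) * t M - \<mu> * u M" using edge_defect_eq[of M] by simp
  have "\<mu> / (\<mu> - \<kappa> - 1) \<le> t M / u M" using bound(2) by (simp add: f_def)
  then have d0: "t (Suc M) - u (Suc M) \<ge> 0"
    unfolding defect using uM m1 by (simp add: field_simps)
  have "u (Suc M) > 0"
  proof -
    \<comment> \<open>Splitting off a path with no edges lets the weak inequality \<open>d0\<close>
      suffice, since \<open>u M * u 0 = u M\<close> is already positive.\<close>
    have "0 \<le> u (Suc M) * u (Suc 0) - u M * u 0"
      using defect_u[of M 0] d0 alpha_pos by (metis mult_nonneg_nonneg less_imp_le add_Suc_right add_0_right)
    then have "u (Suc M) * u (Suc 0) > 0" using uM by simp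
    moreover have "u (Suc 0) > 0" using u_1 m1 by simp
    ultimately show ?thesis by (simp add: zero_less_mult_iff)
  qed
  then have "good (Suc M)" using bound(1) by (auto simp: good_def le_Suc_eq)
  moreover have cardP: "card EP = Suc M" using card cardE by simp
  ultimately have "good (card EP)" by simp
  then obtain z where z: "\<forall>v\<in>VP. z v > 0" "z r' = u (Suc M)"
    "\<forall>v\<in>VP - {r'}. flow EP z v = (\<mu> - 1) * z v" "flow EP z r' = \<mu> * u (Suc M) - t (Suc M)"
    using rooted_path_vector[OF kk rp] unfolding cardP by blast
  have r': "r' \<in> VP" using rooted_path_basic(3)[OF rp k2] .
  have scale: "(\<mu> - 1) * c / (real k - 1) = \<rho> * c" for c using k by (simp add: \<mu>_def)
  have fr: "flow EP z r' = (\<mu> - 1) * z r' - (t (Suc M) - u (Suc M))"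
    using z(2,4) by (simp add: algebra_simps)
  have super: "(\<Sum>j\<in>VP. adj EP i j * z j) \<le> \<rho> * z i" if i: "i \<in> VP" for i
  proof -
    have "flow EP z i \<le> (\<mu> - 1) * z i" using z(3) fr d0 i by (cases "i = r'") auto
    then show ?thesis unfolding adj_sum_flow[OF hgP unP i] scale[symmetric]
      using k by (intro divide_right_mono) auto
  qed
  note cmp = spectral_radius_le_supersolution[OF hgP conP z(1)[rule_format] super]
  show "spectral_radius VP EP \<le> spectral_radius V E" using cmp(1) by (simp add: \<rho>_def)
  assume eq: "spectral_radius VP EP = spectral_radius V E"
  have "t (Suc M) - u (Suc M) = 0"
  proof (rule ccontr)
    assume "t (Suc M) - u (Suc M) \<noteq> 0"
    then have "flow EP z r' < (\<mu> - 1) * z r'" using fr d0 by linarith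
    then have "(\<Sum>j\<in>VP. adj EP r' j * z j) < \<rho> * z r'"
      unfolding adj_sum_flow[OF hgP unP r'] scale[symmetric]
      using k by (intro divide_strict_right_mono) auto
    then have "spectral_radius VP EP < \<rho>" using cmp(2)[of r'] r' by simp
    then show False using eq by (simp add: \<rho>_def)
  qed
  then have "t M / u M = \<mu> / (\<mu> - \<kappa> - 1)" unfolding defect using uM m1 by (simp add: field_simps)
  then have rpw: "rooted_path k w (Vf w) (Ef w)" using bound(3) by (simp add: f_def)
  have "e - {w} \<noteq> {}" using s(1,2) k2 gf(1)
    by (metis One_nat_def card.empty card_Suc_Diff1 not_less_eq_eq numeral_2_eq_2 order_refl)
  then obtain r where r: "r \<in> e" "r \<noteq> w" by blast
  have "rooted_path k r (Vf w \<union> e) (insert e (Ef w))"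
    using path_step[OF rpw s(2) r(1) s(1) r(2)] gf(2)[OF s(1)] by blast
  moreover have "E = insert e (Ef w)" "V = Vf w \<union> e"
  proof -
    have e: "e = insert w (e - {w})" using s(1) by blast
    have "(\<Union>v\<in>e - {w}. Ef v) = {}" "(\<Union>v\<in>e - {w}. Vf v) = e - {w}" using s(7) by auto
    then have U: "(\<Union>v\<in>e. Ef v) = Ef w" "(\<Union>v\<in>e. Vf v) = Vf w \<union> (e - {w})"
      by (metis UN_insert e sup_bot.right_neutral)+
    show "E = insert e (Ef w)" unfolding s(6) U(1) ..
    show "V = Vf w \<union> e" unfolding s(5) U(2) using eV(1)[OF s(1)] by blast
  qed
  ultimately show "\<exists>r. rooted_path k r V E" by blast
qed

theorem theorem1p3:
  fixes V :: "'a set" and E :: "'a set set" and VP :: "'b set" and EP :: "'b set set"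
    and k n :: nat
  assumes "k \<ge> 3"
    and "supertree V E" and "k_uniform k E" and "card V = n"
    and "hyperpath_hypergraph VP EP" and "k_uniform k EP" and "card VP = n"
  shows "spectral_radius VP EP \<le> spectral_radius V E \<and>
         (spectral_radius VP EP = spectral_radius V E \<longleftrightarrow> hg_isomorphic V E VP EP)"
proof -
  have k2: "k \<ge> 2" using assms(1) by simp
  have hg: "hypergraph V E" using assms(2) by (simp add: supertree_def)
  have hgP: "hypergraph VP EP" using assms(5) by (simp add: hyperpath_hypergraph_def)
  obtain vs es where P: "hyperpath vs es" "EP = set es" "VP = set vs \<union> \<Union>(set es)"
    using assms(5) unfolding hyperpath_hypergraph_def by blast
  have rp: "rooted_path k (hd vs) VP EP"
    using hyperpath_rooted_path[OF P(1), of k] assms(6) P(2,3) by (simp add: k_uniform_def)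
  obtain r where r: "r \<in> V" using hg by (auto simp: hypergraph_def)
  have rt: "rooted_supertree k r V E" using supertree_rooted[OF assms(2,3) r] .
  have "card E * (k - 1) = card EP * (k - 1)"
    using rooted_supertree_card[OF rt k2] rooted_path_basic(5)[OF rp k2] assms(4,7) by simp
  then have card: "card E = card EP" using assms(1) by simp
  have iso: "hg_isomorphic V E VP EP" if "rooted_path k r V E" for r
    using rooted_path_isomorphic[OF that rp card k2] unfolding hg_isomorphic_def by blast
  have eq: "spectral_radius VP EP = spectral_radius V E" if "hg_isomorphic V E VP EP"
    using isomorphic_spectral_radius[OF hg that] by simp
  show ?thesis
  proof (cases "E = {}")
    case True
    then have "rooted_path k r V E" using rooted_supertree_trivial[OF rt] by (simp add: path_single)
    then show ?thesis using iso eq by auto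
  next
    case False
    note cmp = supertree_vs_rooted_path[OF assms(1-3) False rp hgP card]
    show ?thesis using cmp iso eq by blast
  qed
qed

end
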